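(* Let $X\subseteq\mathbb{R}^n$ be r.e. open. (a) Every computable open $f:X\to\mathbb{R}$ is effectively open. More generally, if a computable open $f:X\to\mathbb{R}^m$ maps every open ball $B\subseteq X$ to a convex set $f[B]\subseteq\mathbb{R}^m$, then $f$ is effectively open. (b) Every surjective computable affinely linear mapping $\mathbb{R}^n\to\mathbb{R}^m$ is effectively open. (c) If computable $f:X\to\mathbb{R}^m$ is continuously differentiable, its derivative $f'$ is computable, and $f'(\vec x)$ has rank $m$ for every $\vec x\in X$, then $f$ is effectively open. (d) Let $f:X\to\mathbb{R}^n$ be computable and $h:X\rightrightarrows\mathbb{N}$ be a computable multi-valued function such that for every $\vec x\in X$ and every $\ell\in h(\vec x)$ the restriction of $f$ to $B(\vec x,2^{-\ell})\cap X$ is injective. Then $f$ is effectively open. (e) If $X$ is bounded and $f:\overline{X}\to\mathbb{R}^n$ is computable and locally injective (each point has a neighbourhood ball on which $f$ is injective), then $f|_X$ is effectively open. The same holds if $f:X\to\mathbb{R}^n$ is computable and globally injective.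
   Context: Type-2 computability (Weihrauch) with the Cauchy representation $\rho^n$ for $\mathbb{R}^n$ and $\theta^d_<$ for open subsets of $\mathbb{R}^d$ (a name lists rational centers and radii of open balls whose union is the set). $X$ r.e. open: has a computable $\theta^n_<$-name. An open function $f:X\to\mathbb{R}^m$ is effectively open if $U\mapsto f[U]$ on open $U\subseteq X$ is $(\theta^n_<\to\theta^m_<)$-computable. A multi-valued $h:X\rightrightarrows\mathbb{N}$ is computable if some machine, on any $\rho^n$-name of $\vec x$, outputs some element of $h(\vec x)$ (possibly depending on the name). $B(\vec x,r)$: open Euclidean ball. *)

theory Defs
  imports "HOL-Analysis.Analysis" "HOL-Library.Nat_Bijection"
begin

datatype recf =
    Zr
  | Sc
  | Pj nat
  | Cn recf "recf list"
  | Pr recf recf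
  | Mn recf

inductive recf_eval :: "recf \<Rightarrow> nat list \<Rightarrow> nat \<Rightarrow> bool" where
  zr: "recf_eval Zr xs 0"
| sc: "recf_eval Sc (x # xs) (Suc x)"
| pj: "i < length xs \<Longrightarrow> recf_eval (Pj i) xs (xs ! i)"
| cn: "list_all2 (\<lambda>g y. recf_eval g xs y) gs ys \<Longrightarrow> recf_eval f ys z \<Longrightarrow> recf_eval (Cn f gs) xs z"
| pr0: "recf_eval f xs y \<Longrightarrow> recf_eval (Pr f g) (0 # xs) y"
| prS: "recf_eval (Pr f g) (n # xs) y \<Longrightarrow> recf_eval g (n # y # xs) z
        \<Longrightarrow> recf_eval (Pr f g) (Suc n # xs) z"
| mn: "recf_eval f (n # xs) 0 \<Longrightarrow> (\<forall>k<n. \<exists>y. recf_eval f (k # xs) (Suc y))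
        \<Longrightarrow> recf_eval (Mn f) xs n"

definition total_recursive :: "(nat \<Rightarrow> nat) \<Rightarrow> bool" where
  "total_recursive e \<longleftrightarrow> (\<exists>c. \<forall>x. recf_eval c [x] (e x))"

definition prefix_code :: "(nat \<Rightarrow> nat) \<Rightarrow> nat \<Rightarrow> nat" where
  "prefix_code p m = list_encode (map p [0..<m])"

text \<open>F is computable on the set of names D: a total recursive e, given a finite
  prefix w of the input and an output position n, answers 0 ("not yet known")
  or Suc k ("the n-th output symbol is k"); every such answer on prefixes of
  p \<in> D is correct, and every output symbol is eventually determined.
  (Standard characterization of functions computed by Type-2 machines.)\<close>
definition type2_computable :: "(nat \<Rightarrow> nat) set \<Rightarrow> ((nat \<Rightarrow> nat) \<Rightarrow> (nat \<Rightarrow> nat)) \<Rightarrow> bool" where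
  "type2_computable D F \<longleftrightarrow> (\<exists>e. total_recursive e \<and>
     (\<forall>p\<in>D. \<forall>n.
        (\<exists>m. e (prod_encode (prefix_code p m, n)) \<noteq> 0) \<and>
        (\<forall>m. e (prod_encode (prefix_code p m, n)) \<noteq> 0 \<longrightarrow>
             e (prod_encode (prefix_code p m, n)) = Suc (F p n))))"

text \<open>A fixed enumeration of the standard basis of a Euclidean space
  (coordinate order; any choice gives computably equivalent representations).\<close>
definition basis_enum :: "nat \<Rightarrow> 'a::euclidean_space" where
  "basis_enum = (SOME e. bij_betw e {..<DIM('a)} Basis)"

definition qdec :: "nat \<Rightarrow> real" where
  "qdec k = (case prod_decode k of (a, b) \<Rightarrow> of_int (int_decode a) / real (Suc b))"

definition qpoint :: "nat \<Rightarrow> 'a::euclidean_space" where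
  "qpoint k = (\<Sum>i<DIM('a). qdec (nth_default 0 (list_decode k) i) *\<^sub>R basis_enum i)"

definition rho_name :: "(nat \<Rightarrow> nat) \<Rightarrow> 'a::euclidean_space \<Rightarrow> bool" where
  "rho_name p x \<longleftrightarrow> (\<forall>k. dist (qpoint (p k) :: 'a) x \<le> (1/2) ^ k)"

text \<open>Representation theta_< of open sets: p lists rational balls (center, radius)
  whose union is U (a nonpositive radius codes the empty ball).\<close>
definition theta_name :: "(nat \<Rightarrow> nat) \<Rightarrow> 'a::euclidean_space set \<Rightarrow> bool" where
  "theta_name p U \<longleftrightarrow>
     U = (\<Union>k. ball (qpoint (fst (prod_decode (p k)))) (qdec (snd (prod_decode (p k)))))"

definition re_open :: "'a::euclidean_space set \<Rightarrow> bool" where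
  "re_open X \<longleftrightarrow> (\<exists>p. total_recursive p \<and> theta_name p X)"

definition computable_on :: "'a::euclidean_space set \<Rightarrow> ('a \<Rightarrow> 'b::euclidean_space) \<Rightarrow> bool" where
  "computable_on X f \<longleftrightarrow> (\<exists>F.
     type2_computable {p. \<exists>x\<in>X. rho_name p x} F \<and>
     (\<forall>p x. x \<in> X \<and> rho_name p x \<longrightarrow> rho_name (F p) (f x)))"

definition mv_computable :: "'a::euclidean_space set \<Rightarrow> ('a \<Rightarrow> nat set) \<Rightarrow> bool" where
  "mv_computable X h \<longleftrightarrow> (\<exists>e. total_recursive e \<and>
     (\<forall>p x. x \<in> X \<and> rho_name p x \<longrightarrow>
        (\<exists>m. e (prefix_code p m) \<noteq> 0) \<and>
        (\<forall>m. e (prefix_code p m) \<noteq> 0 \<longrightarrow> e (prefix_code p m) - 1 \<in> h x)))"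

definition open_on :: "'a::euclidean_space set \<Rightarrow> ('a \<Rightarrow> 'b::euclidean_space) \<Rightarrow> bool" where
  "open_on X f \<longleftrightarrow> (\<forall>U. open U \<and> U \<subseteq> X \<longrightarrow> open (f ` U))"

definition effectively_open :: "'a::euclidean_space set \<Rightarrow> ('a \<Rightarrow> 'b::euclidean_space) \<Rightarrow> bool" where
  "effectively_open X f \<longleftrightarrow> (\<exists>F.
     type2_computable {p. \<exists>U. open U \<and> U \<subseteq> X \<and> theta_name p U} F \<and>
     (\<forall>p U. open U \<and> U \<subseteq> X \<and> theta_name p U \<longrightarrow> theta_name (F p) (f ` U)))"

end

theory Submission
  imports Defs
begin

text \<open>
  A map \<open>f\<close> is effectively open once there is a semidecidable relation between rational balls
  \<open>b \<subseteq> X\<close> and \<open>c\<close> such that the image of \<open>b\<close> is the union of the related \<open>c\<close>.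
  Computability of \<open>f\<close> makes ``\<open>f\<close> maps \<open>b\<close> into \<open>c\<close>'' semidecidable in a form that holds for all
  small \<open>b\<close> around a point with image in \<open>c\<close>; in particular it is semidecidable that the image of \<open>b\<close> meets \<open>c\<close>.

  If images of balls are convex, \<open>c \<subseteq> f[b]\<close> follows when \<open>f[b]\<close> meets suitable balls placed around \<open>c\<close>
  on both sides of each coordinate axis. If \<open>f\<close> is locally injective, it is open by invariance of domain,
  and \<open>c \<subseteq> f[b]\<close> follows when \<open>c\<close> meets the image of a ball inside \<open>b\<close> but misses the image of a compact
  shell around it; compactness makes this semidecidable by means of finite grids.
  If \<open>f'\<close> is surjective everywhere, a rational approximate right inverse of \<open>f'\<close> near a point gives an
  affine slice on which \<open>f\<close> is close to the identity, and hence an explicit ball in the image.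
\<close>

section \<open>Recursive functions\<close>

text \<open>The image of a union is the union of the images, so it is enough to list, for each ball
  of the input, rational balls that exhaust its image. Whether \<open>b \<subseteq> X\<close> is
  never tested: the listed balls satisfy it by the promise on the input. A found certificate must
  force \<open>c \<subseteq> f[b]\<close>, whereas completeness only asks that some certificate
  exists, so its proof may use choice, compactness and invariance of domain without effective
  bounds. The obstacle is soundness: approximate knowledge of values never yields an inclusion into
  an image by itself. A topological fact has to supply it, namely separation by hyperplanes,
  connectedness of \<open>c\<close>, or Brouwer's theorem. To stay searchable, certificates compare
  rational centres and radii by decidable inequalities, use enclosures of \<open>f\<close> only
  positively, and quantify universally only over finite ranges.\<close>

definition recursive_fun :: "nat \<Rightarrow> (nat list \<Rightarrow> nat) \<Rightarrow> bool" where
  "recursive_fun k f \<longleftrightarrow> (\<exists>c. \<forall>xs. length xs = k \<longrightarrow> recf_eval c xs (f xs))"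

lemma recursive_fun_zero: "recursive_fun k (\<lambda>xs. 0)"
  unfolding recursive_fun_def using recf_eval.zr by blast

lemma recursive_fun_nth: "i < k \<Longrightarrow> recursive_fun k (\<lambda>xs. xs ! i)"
  unfolding recursive_fun_def using recf_eval.pj by blast

lemma recursive_fun_comp1:
  assumes "recursive_fun 1 (\<lambda>xs. h (xs ! 0))" "recursive_fun k f"
  shows "recursive_fun k (\<lambda>xs. h (f xs))"
proof -
  obtain c d where c: "\<And>xs. length xs = 1 \<Longrightarrow> recf_eval c xs (h (xs ! 0))"
    and d: "\<And>xs. length xs = k \<Longrightarrow> recf_eval d xs (f xs)"
    using assms unfolding recursive_fun_def by blast
  have "recf_eval (Cn c [d]) xs (h (f xs))" if "length xs = k" for xs
    by (rule recf_eval.cn[where ys = "[f xs]"]) (use c[of "[f xs]"] d[OF that] in auto)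
  then show ?thesis unfolding recursive_fun_def by blast
qed

lemma recursive_fun_comp2:
  assumes "recursive_fun 2 (\<lambda>xs. h (xs ! 0) (xs ! 1))" "recursive_fun k f" "recursive_fun k g"
  shows "recursive_fun k (\<lambda>xs. h (f xs) (g xs))"
proof -
  obtain c d e where c: "\<And>xs. length xs = 2 \<Longrightarrow> recf_eval c xs (h (xs ! 0) (xs ! 1))"
    and d: "\<And>xs. length xs = k \<Longrightarrow> recf_eval d xs (f xs)"
    and e: "\<And>xs. length xs = k \<Longrightarrow> recf_eval e xs (g xs)"
    using assms unfolding recursive_fun_def by blast
  have "recf_eval (Cn c [d, e]) xs (h (f xs) (g xs))" if "length xs = k" for xs
    by (rule recf_eval.cn[where ys = "[f xs, g xs]"])
      (use c[of "[f xs, g xs]"] d[OF that] e[OF that] in auto)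
  then show ?thesis unfolding recursive_fun_def by blast
qed

lemma recursive_fun_Suc:
  assumes "recursive_fun k f"
  shows "recursive_fun k (\<lambda>xs. Suc (f xs))"
proof (rule recursive_fun_comp1[OF _ assms])
  have "recf_eval Sc xs (Suc (xs ! 0))" if "length xs = 1" for xs
    using that recf_eval.sc[of "hd xs" "tl xs"] by (cases xs) auto
  then show "recursive_fun 1 (\<lambda>xs. Suc (xs ! 0))"
    unfolding recursive_fun_def by blast
qed

lemma recursive_fun_prec:
  assumes "recursive_fun k a" "recursive_fun (Suc (Suc k)) b"
  shows "recursive_fun (Suc k) (\<lambda>xs. rec_nat (a (tl xs)) (\<lambda>n y. b (n # y # tl xs)) (xs ! 0))"
proof -
  obtain c d where c: "\<And>xs. length xs = k \<Longrightarrow> recf_eval c xs (a xs)"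
    and d: "\<And>xs. length xs = Suc (Suc k) \<Longrightarrow> recf_eval d xs (b xs)"
    using assms unfolding recursive_fun_def by blast
  have "recf_eval (Pr c d) (n # ys) (rec_nat (a ys) (\<lambda>n y. b (n # y # ys)) n)"
    if "length ys = k" for n ys
  proof (induction n)
    case (Suc n)
    then show ?case using that by (auto intro!: recf_eval.prS[OF Suc] d)
  qed (use that in \<open>auto intro: recf_eval.pr0 c\<close>)
  then have "recf_eval (Pr c d) xs (rec_nat (a (tl xs)) (\<lambda>n y. b (n # y # tl xs)) (xs ! 0))"
    if "length xs = Suc k" for xs
    using that by (cases xs) auto
  then show ?thesis unfolding recursive_fun_def by blast
qed

lemma recursive_fun_cong:
  "recursive_fun k f \<Longrightarrow> (\<And>xs. length xs = k \<Longrightarrow> f xs = g xs) \<Longrightarrow> recursive_fun k g"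
  unfolding recursive_fun_def by metis

lemma total_recursive_iff: "total_recursive e \<longleftrightarrow> recursive_fun 1 (\<lambda>xs. e (xs ! 0))"
proof -
  have "(\<forall>x. recf_eval c [x] (e x)) \<longleftrightarrow>
    (\<forall>xs. length xs = 1 \<longrightarrow> recf_eval c xs (e (xs ! 0)))" for c
    by (auto simp: length_Suc_conv)
  then show ?thesis
    unfolding total_recursive_def recursive_fun_def by simp
qed

lemma recursive_fun_total_recursive:
  "total_recursive e \<Longrightarrow> recursive_fun k f \<Longrightarrow> recursive_fun k (\<lambda>xs. e (f xs))"
  unfolding total_recursive_iff by (rule recursive_fun_comp1)

lemma recursive_fun_2I:
  assumes "recursive_fun (Suc 1) f" "\<And>x y. f [x, y] = h x y"
  shows "recursive_fun 2 (\<lambda>xs. h (xs ! 0) (xs ! 1))"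
  using assms(1) unfolding numeral_2_eq_2 One_nat_def
  by (rule recursive_fun_cong) (auto simp: length_Suc_conv assms(2))

lemma recursive_fun_add:
  assumes "recursive_fun k f" "recursive_fun k g"
  shows "recursive_fun k (\<lambda>xs. f xs + g xs)"
proof (rule recursive_fun_comp2[OF _ assms])
  have "rec_nat y (\<lambda>n y. Suc y) x = x + y" for x y
    by (induction x) auto
  then show "recursive_fun 2 (\<lambda>xs. xs ! 0 + xs ! 1)"
    by (intro recursive_fun_2I[OF recursive_fun_prec[OF recursive_fun_nth[of 0]
      recursive_fun_Suc[OF recursive_fun_nth[of 1]]]]) auto
qed

lemma recursive_fun_diff:
  assumes "recursive_fun k f" "recursive_fun k g"
  shows "recursive_fun k (\<lambda>xs. f xs - g xs)"
proof (rule recursive_fun_comp2[OF _ assms(2,1), where h = "\<lambda>x y. y - x"])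
  have eq: "rec_nat 0 (\<lambda>n y. n) x = x - 1" for x
    by (cases x) auto
  have pred: "recursive_fun 1 (\<lambda>xs. xs ! 0 - 1)"
    using recursive_fun_prec[OF recursive_fun_zero[of 0] recursive_fun_nth[of 0 "Suc (Suc 0)"]]
    unfolding One_nat_def by (rule recursive_fun_cong) (auto simp: eq[simplified])
  have "rec_nat y (\<lambda>n y. y - 1) x = y - x" for x y :: nat
    by (induction x) auto
  then show "recursive_fun 2 (\<lambda>xs. xs ! 1 - xs ! 0)"
    by (intro recursive_fun_2I[OF recursive_fun_prec[OF recursive_fun_nth[of 0]
      recursive_fun_comp1[OF pred recursive_fun_nth[of 1]]]]) auto
qed

lemma recursive_fun_triangle:
  assumes "recursive_fun k f"
  shows "recursive_fun k (\<lambda>xs. triangle (f xs))"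
proof (rule recursive_fun_comp1[OF _ assms])
  have eq: "rec_nat 0 (\<lambda>n y. y + Suc n) x = triangle x" for x
    by (induction x) auto
  have "recursive_fun (Suc (Suc 0)) (\<lambda>xs. xs ! 1 + Suc (xs ! 0))"
    by (intro recursive_fun_add recursive_fun_Suc recursive_fun_nth) auto
  from recursive_fun_prec[OF recursive_fun_zero this]
  show "recursive_fun 1 (\<lambda>xs. triangle (xs ! 0))"
    unfolding One_nat_def by (rule recursive_fun_cong) (simp add: eq[simplified])
qed

lemma recursive_fun_prod_encode:
  assumes "recursive_fun k f" "recursive_fun k g"
  shows "recursive_fun k (\<lambda>xs. prod_encode (f xs, g xs))"
  unfolding prod_encode_def
  by (simp, intro recursive_fun_add recursive_fun_triangle assms)

text \<open>Serves to invert the pairing function. The existence hypothesis keeps the search total,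
  and below the least zero all values are successors, as the rule for \<open>Mn\<close>
  demands.\<close>

lemma recursive_fun_Mn:
  assumes "recursive_fun 2 f" "\<And>x. \<exists>n. f [n, x] = 0"
  shows "total_recursive (\<lambda>x. LEAST n. f [n, x] = 0)"
proof -
  obtain c where c: "\<And>xs. length xs = 2 \<Longrightarrow> recf_eval c xs (f xs)"
    using assms(1) unfolding recursive_fun_def by blast
  have "recf_eval (Mn c) [x] (LEAST n. f [n, x] = 0)" for x
  proof (rule recf_eval.mn)
    show "recf_eval c [LEAST n. f [n, x] = 0, x] 0"
      using c[of "[LEAST n. f [n, x] = 0, x]"] LeastI_ex[OF assms(2)[of x]] by simp
    show "\<forall>k<LEAST n. f [n, x] = 0. \<exists>y. recf_eval c [k, x] (Suc y)"
    proof (intro allI impI)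
      fix k assume "k < (LEAST n. f [n, x] = 0)"
      then obtain y where "f [k, x] = Suc y"
        by (meson not0_implies_Suc not_less_Least)
      then show "\<exists>y. recf_eval c [k, x] (Suc y)" using c[of "[k, x]"] by auto
    qed
  qed
  then show ?thesis unfolding total_recursive_def by blast
qed

section \<open>Unary recursive functions and the inverse of the pairing function\<close>

named_theorems recursive_intros

lemma total_recursive_const [recursive_intros]: "total_recursive (\<lambda>u. c)"
proof -
  have "recursive_fun 1 (\<lambda>u. c)"
    by (induction c) (auto intro: recursive_fun_zero recursive_fun_Suc)
  then show ?thesis by (simp add: total_recursive_iff)
qed

lemma total_recursive_id [recursive_intros]: "total_recursive (\<lambda>u. u)"
  by (simp add: total_recursive_iff recursive_fun_nth)

lemma total_recursive_comp:
  "total_recursive e \<Longrightarrow> total_recursive f \<Longrightarrow> total_recursive (\<lambda>u. e (f u))"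
  unfolding total_recursive_iff by (rule recursive_fun_comp1)

lemma total_recursive_Suc [recursive_intros]:
  "total_recursive f \<Longrightarrow> total_recursive (\<lambda>u. Suc (f u))"
  unfolding total_recursive_iff by (rule recursive_fun_Suc)

lemma total_recursive_add [recursive_intros]:
  "total_recursive f \<Longrightarrow> total_recursive g \<Longrightarrow> total_recursive (\<lambda>u. f u + g u)"
  unfolding total_recursive_iff by (rule recursive_fun_add)

lemma total_recursive_diff [recursive_intros]:
  "total_recursive f \<Longrightarrow> total_recursive g \<Longrightarrow> total_recursive (\<lambda>u. f u - g u)"
  unfolding total_recursive_iff by (rule recursive_fun_diff)

lemma total_recursive_prod_encode [recursive_intros]:
  "total_recursive f \<Longrightarrow> total_recursive g \<Longrightarrow> total_recursive (\<lambda>u. prod_encode (f u, g u))"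
  unfolding total_recursive_iff by (rule recursive_fun_prod_encode)

abbreviation pfst :: "nat \<Rightarrow> nat" where "pfst u \<equiv> fst (prod_decode u)"
abbreviation psnd :: "nat \<Rightarrow> nat" where "psnd u \<equiv> snd (prod_decode u)"

lemma triangle_mono: "m \<le> n \<Longrightarrow> triangle m \<le> triangle n"
  by (induction n) (auto simp: le_Suc_eq)

text \<open>Since \<open>prod_encode (m, n)\<close> is \<open>triangle (m + n) + m\<close>, the code
  lies on the diagonal \<open>m + n\<close>. Truncated subtraction turns "the code is below
  \<open>triangle (Suc s)\<close>" into an equation with 0, the form that minimisation can search
  for.\<close>

lemma Least_triangle: "(LEAST s. Suc (prod_encode (m, n)) - triangle (Suc s) = 0) = m + n"
proof (rule Least_equality)
  show "Suc (prod_encode (m, n)) - triangle (Suc (m + n)) = 0"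
    by (simp add: prod_encode_def)
  fix s assume "Suc (prod_encode (m, n)) - triangle (Suc s) = 0"
  then have *: "triangle (m + n) < triangle (Suc s)" by (simp add: prod_encode_def)
  show "m + n \<le> s"
  proof (rule ccontr)
    assume "\<not> m + n \<le> s"
    then have "triangle (Suc s) \<le> triangle (m + n)" by (intro triangle_mono) auto
    with * show False by simp
  qed
qed

lemma total_recursive_pfst_psnd: "total_recursive pfst" "total_recursive psnd"
proof -
  \<comment> \<open>The diagonal of \<open>x\<close>: what exceeds \<open>triangle (s x)\<close> is
    the first component, and the rest of the diagonal is the second.\<close>
  define s where "s x = (LEAST s. Suc x - triangle (Suc s) = 0)" for x
  have s: "s x = pfst x + psnd x" for x
    using Least_triangle[of "pfst x" "psnd x"] by (simp add: s_def)
  have f: "x - triangle (s x) = pfst x" for x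
  proof -
    obtain m n where "x = prod_encode (m, n)" by (metis prod_decode_inverse surj_pair)
    then have "pfst x = m" "psnd x = n" "x = triangle (m + n) + m"
      by (simp_all, simp add: prod_encode_def)
    then show ?thesis unfolding s by simp
  qed
  have "total_recursive (\<lambda>x. LEAST s. (\<lambda>xs. Suc (xs ! 1) - triangle (Suc (xs ! 0))) [s, x] = 0)"
  proof (rule recursive_fun_Mn)
    show "recursive_fun 2 (\<lambda>xs. Suc (xs ! 1) - triangle (Suc (xs ! 0)))"
      by (intro recursive_fun_diff recursive_fun_Suc recursive_fun_triangle recursive_fun_nth) auto
    fix x show "\<exists>n. Suc ([n, x] ! 1) - triangle (Suc ([n, x] ! 0)) = 0"
      by (rule exI[of _ x]) auto
  qed
  then have ts: "total_recursive s" by (simp add: s_def[abs_def])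
  have tt: "total_recursive (\<lambda>x. triangle (s x))"
    using ts unfolding total_recursive_iff by (rule recursive_fun_triangle)
  show *: "total_recursive pfst"
    using total_recursive_diff[OF total_recursive_id tt] by (simp add: f)
  show "total_recursive psnd"
    using total_recursive_diff[OF ts *] by (simp add: s)
qed

lemmas total_recursive_pfst [recursive_intros] = total_recursive_comp[OF total_recursive_pfst_psnd(1)]
lemmas total_recursive_psnd [recursive_intros] = total_recursive_comp[OF total_recursive_pfst_psnd(2)]

text \<open>The parameter is packed with the counter and the accumulator into one number, so that
  all functions stay unary and the closure rules can be applied by syntax alone.\<close>

lemma total_recursive_prec [recursive_intros]:
  assumes a: "total_recursive a"
    and b: "total_recursive (\<lambda>v. b (pfst v) (pfst (psnd v)) (psnd (psnd v)))"
    and n: "total_recursive n"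
  shows "total_recursive (\<lambda>u. rec_nat (a u) (b u) (n u))"
proof -
  have "recursive_fun (Suc (Suc 1)) (\<lambda>xs. prod_encode (xs ! 2, prod_encode (xs ! 0, xs ! 1)))"
    by (intro recursive_fun_prod_encode recursive_fun_nth) auto
  from recursive_fun_prec[OF a[unfolded total_recursive_iff] recursive_fun_total_recursive[OF b this]]
  have "recursive_fun 2 (\<lambda>xs. rec_nat (a (xs ! 1)) (b (xs ! 1)) (xs ! 0))"
    by (rule recursive_fun_2I) simp
  from recursive_fun_comp2[OF this n[unfolded total_recursive_iff] recursive_fun_nth[of 0]]
  show ?thesis unfolding total_recursive_iff by simp
qed

lemma total_recursive_mult [recursive_intros]:
  assumes "total_recursive f" "total_recursive g"
  shows "total_recursive (\<lambda>u. f u * g u)"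
proof -
  have eq: "rec_nat 0 (\<lambda>k y. y + x) n = n * x" for x n :: nat
    by (induction n) auto
  have "total_recursive (\<lambda>u. rec_nat 0 (\<lambda>k y. y + g u) (f u))"
    by (intro recursive_intros total_recursive_comp[OF assms(2)] assms)
  then show ?thesis by (simp add: eq)
qed

section \<open>Decidable and semidecidable predicates\<close>

definition decidable :: "(nat \<Rightarrow> bool) \<Rightarrow> bool" where
  "decidable P \<longleftrightarrow> total_recursive (\<lambda>u. of_bool (P u))"

lemma decidableI: "total_recursive f \<Longrightarrow> (\<And>u. P u \<longleftrightarrow> f u = 0) \<Longrightarrow> decidable P"
proof -
  assume f: "total_recursive f" and P: "\<And>u. P u \<longleftrightarrow> f u = 0"
  have "total_recursive (\<lambda>u. 1 - f u)" by (intro recursive_intros f)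
  moreover have "1 - f u = of_bool (P u)" for u using P[of u] by auto
  ultimately show ?thesis unfolding decidable_def by simp
qed

lemma decidable_const [recursive_intros]: "decidable (\<lambda>u. b)"
  unfolding decidable_def by (rule total_recursive_const)

lemma decidable_not [recursive_intros]:
  assumes "decidable P" shows "decidable (\<lambda>u. \<not> P u)"
  by (rule decidableI[OF assms[unfolded decidable_def]]) auto

lemma decidable_conj [recursive_intros]:
  assumes "decidable P" "decidable Q" shows "decidable (\<lambda>u. P u \<and> Q u)"
  using total_recursive_mult[OF assms[unfolded decidable_def]]
  unfolding decidable_def by (simp add: of_bool_conj)

lemma decidable_disj [recursive_intros]:
  assumes "decidable P" "decidable Q" shows "decidable (\<lambda>u. P u \<or> Q u)"
proof -
  have "decidable (\<lambda>u. \<not> (\<not> P u \<and> \<not> Q u))" by (intro recursive_intros assms)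
  then show ?thesis by simp
qed

lemma decidable_le [recursive_intros]:
  assumes "total_recursive f" "total_recursive g" shows "decidable (\<lambda>u. f u \<le> g u)"
  by (rule decidableI[OF total_recursive_diff[OF assms]]) auto

lemma decidable_eq [recursive_intros]:
  assumes "total_recursive f" "total_recursive g" shows "decidable (\<lambda>u. f u = g u)"
  using decidable_conj[OF decidable_le[OF assms] decidable_le[OF assms(2,1)]]
  by (simp add: eq_iff)

lemma total_recursive_if [recursive_intros]:
  assumes "decidable P" "total_recursive f" "total_recursive g"
  shows "total_recursive (\<lambda>u. if P u then f u else g u)"
proof -
  have "total_recursive (\<lambda>u. of_bool (P u) * f u + (1 - of_bool (P u)) * g u)"
    using assms(1) unfolding decidable_def by (intro recursive_intros assms)
  moreover have "of_bool (P u) * f u + (1 - of_bool (P u)) * g u = (if P u then f u else g u)" for u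
    by simp
  ultimately show ?thesis by simp
qed

lemma total_recursive_funpow [recursive_intros]:
  assumes "total_recursive e" "total_recursive f" "total_recursive n"
  shows "total_recursive (\<lambda>u. (e ^^ n u) (f u))"
proof -
  have eq: "rec_nat x (\<lambda>k y. e y) n = (e ^^ n) x" for x n by (induction n) auto
  have "total_recursive (\<lambda>u. rec_nat (f u) (\<lambda>k y. e y) (n u))"
    by (intro recursive_intros total_recursive_comp[OF assms(1)] assms)
  then show ?thesis by (simp add: eq)
qed

lemma total_recursive_power [recursive_intros]:
  assumes "total_recursive f" "total_recursive n"
  shows "total_recursive (\<lambda>u. f u ^ n u)"
proof -
  have eq: "rec_nat (Suc 0) (\<lambda>k y. x * y) n = x ^ n" for x n :: nat by (induction n) auto
  have "total_recursive (\<lambda>u. rec_nat 1 (\<lambda>k y. f u * y) (n u))"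
    by (intro recursive_intros total_recursive_comp[OF assms(1)] assms)
  then show ?thesis by (simp add: eq)
qed

section \<open>Finite sequences coded as numbers\<close>

abbreviation lnth :: "nat \<Rightarrow> nat \<Rightarrow> nat" where
  "lnth w i \<equiv> nth_default 0 (list_decode w) i"

text \<open>Undoes \<open>list_encode (x # xs) = Suc (prod_encode (x, list_encode xs))\<close>.
  Truncated subtraction and \<open>prod_decode 0 = (0, 0)\<close> make 0, the code of
  \<open>[]\<close>, a fixed point, so reading past the end gives 0, in agreement with
  \<open>nth_default 0\<close>.\<close>

definition ltail :: "nat \<Rightarrow> nat" where
  "ltail w = psnd (w - 1)"

lemma prod_decode_0: "prod_decode 0 = (0, 0)"
  by (simp add: prod_decode_def prod_decode_aux.simps)

lemma list_decode_ltail: "list_decode (ltail w) = tl (list_decode w)"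
  by (cases w) (auto simp: ltail_def prod_decode_0 split: prod.split)

lemma list_decode_ltail_funpow: "list_decode ((ltail ^^ i) w) = drop i (list_decode w)"
  by (induction i) (auto simp: list_decode_ltail drop_Suc tl_drop)

lemma ltail_funpow_eq_0: "(ltail ^^ i) w = 0 \<longleftrightarrow> length (list_decode w) \<le> i"
  using list_decode_ltail_funpow[of i w]
  by (metis drop_eq_Nil2 list_decode.simps(1) list_decode_eq)

lemma lnth_0: "lnth w 0 = pfst (w - 1)"
  by (cases w) (auto simp: prod_decode_0 nth_default_def split: prod.split)

lemma lnth_eq: "lnth w i = pfst ((ltail ^^ i) w - 1)"
proof -
  have "lnth w i = lnth ((ltail ^^ i) w) 0"
    by (simp add: list_decode_ltail_funpow nth_default_def)
  then show ?thesis by (simp only: lnth_0)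
qed

lemma total_recursive_ltail: "total_recursive ltail"
  unfolding ltail_def[abs_def] by (intro recursive_intros)

lemma total_recursive_lnth [recursive_intros]:
  "total_recursive f \<Longrightarrow> total_recursive g \<Longrightarrow> total_recursive (\<lambda>u. lnth (f u) (g u))"
  unfolding lnth_eq by (intro recursive_intros total_recursive_ltail)

lemma decidable_length_le [recursive_intros]:
  "total_recursive f \<Longrightarrow> total_recursive g \<Longrightarrow> decidable (\<lambda>u. length (list_decode (f u)) \<le> g u)"
  unfolding ltail_funpow_eq_0[symmetric] by (intro recursive_intros total_recursive_ltail)

section \<open>Semidecidable predicates and their closure properties\<close>

definition semidecidable :: "(nat \<Rightarrow> bool) \<Rightarrow> bool" where
  "semidecidable P \<longleftrightarrow> (\<exists>D. decidable D \<and> (\<forall>u. P u \<longleftrightarrow> (\<exists>k. D (prod_encode (u, k)))))"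

lemma decidable_comp:
  "decidable P \<Longrightarrow> total_recursive f \<Longrightarrow> decidable (\<lambda>u. P (f u))"
  unfolding decidable_def by (rule total_recursive_comp)

lemma semidecidable_comp:
  assumes "semidecidable P" "total_recursive f"
  shows "semidecidable (\<lambda>u. P (f u))"
proof -
  obtain D where D: "decidable D" "\<And>u. P u \<longleftrightarrow> (\<exists>k. D (prod_encode (u, k)))"
    using assms(1) unfolding semidecidable_def by blast
  have "decidable (\<lambda>v. D (prod_encode (f (pfst v), psnd v)))"
    by (intro decidable_comp[OF D(1)] recursive_intros total_recursive_comp[OF assms(2)])
  then show ?thesis unfolding semidecidable_def
    by (intro exI[of _ "\<lambda>v. D (prod_encode (f (pfst v), psnd v))"]) (simp add: D(2))
qed

text \<open>The witness and the stage at which \<open>P\<close> is confirmed for it are searched for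
  together, as one coded pair.\<close>

lemma semidecidable_exI:
  assumes "semidecidable P" shows "semidecidable (\<lambda>u. \<exists>k. P (prod_encode (u, k)))"
proof -
  obtain D where D: "decidable D" "\<And>u. P u \<longleftrightarrow> (\<exists>k. D (prod_encode (u, k)))"
    using assms(1) unfolding semidecidable_def by blast
  let ?D = "\<lambda>v. D (prod_encode (prod_encode (pfst v, pfst (psnd v)), psnd (psnd v)))"
  have "decidable ?D"
    by (intro decidable_comp[OF D(1)] recursive_intros)
  moreover have "(\<exists>k. P (prod_encode (u, k))) \<longleftrightarrow> (\<exists>k. ?D (prod_encode (u, k)))" for u
  proof
    assume "\<exists>k. P (prod_encode (u, k))"
    then obtain k m where "D (prod_encode (prod_encode (u, k), m))" unfolding D by blast
    then show "\<exists>k. ?D (prod_encode (u, k))"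
      by (intro exI[of _ "prod_encode (k, m)"]) simp
  qed (auto simp: D)
  ultimately show ?thesis unfolding semidecidable_def by blast
qed

lemma semidecidable_ex [recursive_intros]:
  assumes "semidecidable (\<lambda>v. P (pfst v) (psnd v))"
  shows "semidecidable (\<lambda>u. \<exists>k. P u k)"
  using semidecidable_exI[OF assms] by simp

lemma semidecidable_decidable:
  assumes "decidable P" shows "semidecidable P"
  unfolding semidecidable_def
  by (intro exI[of _ "\<lambda>v. P (pfst v)"]) (simp add: decidable_comp[OF assms] recursive_intros)

lemma semidecidable_conj [recursive_intros]:
  assumes "semidecidable P" "semidecidable Q"
  shows "semidecidable (\<lambda>u. P u \<and> Q u)"
proof -
  obtain D E where D: "decidable D" "\<And>u. P u \<longleftrightarrow> (\<exists>k. D (prod_encode (u, k)))"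
    and E: "decidable E" "\<And>u. Q u \<longleftrightarrow> (\<exists>k. E (prod_encode (u, k)))"
    using assms unfolding semidecidable_def by metis
  have "semidecidable (\<lambda>u. \<exists>k l. D (prod_encode (u, k)) \<and> E (prod_encode (u, l)))"
    by (intro semidecidable_ex semidecidable_decidable recursive_intros
        decidable_comp[OF D(1)] decidable_comp[OF E(1)])
  then show ?thesis by (simp add: D E)
qed

lemma semidecidable_disj [recursive_intros]:
  assumes "semidecidable P" "semidecidable Q"
  shows "semidecidable (\<lambda>u. P u \<or> Q u)"
proof -
  obtain D E where D: "decidable D" "\<And>u. P u \<longleftrightarrow> (\<exists>k. D (prod_encode (u, k)))"
    and E: "decidable E" "\<And>u. Q u \<longleftrightarrow> (\<exists>k. E (prod_encode (u, k)))"
    using assms unfolding semidecidable_def by metis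
  have "semidecidable (\<lambda>u. \<exists>k. D (prod_encode (u, k)) \<or> E (prod_encode (u, k)))"
    by (intro semidecidable_ex semidecidable_decidable recursive_intros
        decidable_comp[OF D(1)] decidable_comp[OF E(1)])
  then show ?thesis by (simp add: D E ex_disj_distrib)
qed

lemma semidecidable_ball_finite [recursive_intros]:
  assumes "finite A" "\<And>i. i \<in> A \<Longrightarrow> semidecidable (P i)"
  shows "semidecidable (\<lambda>u. \<forall>i\<in>A. P i u)"
  using assms
proof (induction A rule: finite_induct)
  case empty
  show ?case by (simp add: semidecidable_decidable decidable_const)
next
  case (insert x F)
  then show ?case by (simp add: semidecidable_conj)
qed

lemma decidable_all_less [recursive_intros]:
  assumes P: "decidable (\<lambda>v. P (pfst v) (psnd v))" and n: "total_recursive n"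
  shows "decidable (\<lambda>u. \<forall>k<n u. P u k)"
proof -
  have eq: "rec_nat (Suc 0) (\<lambda>k y. of_bool (Q k) * y) m = of_bool (\<forall>k<m. Q k)" for Q m
    by (induction m) (auto simp: less_Suc_eq)
  have "total_recursive (\<lambda>v. of_bool (P (pfst v) (psnd v)))"
    using P unfolding decidable_def .
  from total_recursive_comp[OF this, of "\<lambda>v. prod_encode (pfst v, pfst (psnd v))"]
  have "total_recursive (\<lambda>v. of_bool (P (pfst v) (pfst (psnd v))))"
    by (simp add: recursive_intros)
  then have "total_recursive (\<lambda>u. rec_nat 1 (\<lambda>k y. of_bool (P u k) * y) (n u))"
    by (intro recursive_intros n)
  then show ?thesis unfolding decidable_def by (simp add: eq)
qed

lemma semidecidable_all_less [recursive_intros]: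
  assumes P: "semidecidable (\<lambda>v. P (pfst v) (psnd v))" and n: "total_recursive n"
  shows "semidecidable (\<lambda>u. \<forall>i<n u. P u i)"
proof -
  obtain D where D: "decidable D" "\<And>u. P (pfst u) (psnd u) \<longleftrightarrow> (\<exists>k. D (prod_encode (u, k)))"
    using P unfolding semidecidable_def by blast
  have eq: "P u i \<longleftrightarrow> (\<exists>k. D (prod_encode (prod_encode (u, i), k)))" for u i
    using D(2)[of "prod_encode (u, i)"] by simp
  \<comment> \<open>Only finitely many stages are needed for the \<open>i < n u\<close>, so one list
    code \<open>w\<close> holds them all and the quantifiers can be exchanged.\<close>
  have "semidecidable (\<lambda>u. \<exists>w. \<forall>i<n u. D (prod_encode (prod_encode (u, i), lnth w i)))"
    by (intro semidecidable_ex semidecidable_decidable recursive_intros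
        decidable_comp[OF D(1)] total_recursive_comp[OF n])
  moreover have "(\<exists>w. \<forall>i<n u. D (prod_encode (prod_encode (u, i), lnth w i))) \<longleftrightarrow> (\<forall>i<n u. P u i)" for u
  proof
    assume "\<forall>i<n u. P u i"
    then obtain K where K: "\<And>i. i < n u \<Longrightarrow> D (prod_encode (prod_encode (u, i), K i))"
      unfolding eq by metis
    show "\<exists>w. \<forall>i<n u. D (prod_encode (prod_encode (u, i), lnth w i))"
      by (rule exI[of _ "list_encode (map K [0..<n u])"]) (simp add: nth_default_def K)
  qed (auto simp: eq)
  ultimately show ?thesis by simp
qed

text \<open>A list of length \<open>Suc d\<close> is a bounded head followed by a list of length
  \<open>d\<close>, so the quantifier unfolds into nested bounded ones. It will run over the points
  of a finite grid.\<close>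

lemma semidecidable_all_lists:
  assumes "semidecidable (\<lambda>v. P (pfst v) (psnd v))" "total_recursive n"
  shows "semidecidable (\<lambda>u. \<forall>xs. length xs = d \<and> (\<forall>x\<in>set xs. x < n u) \<longrightarrow> P u (list_encode xs))"
  using assms
proof (induction d arbitrary: P n)
  case 0
  have "semidecidable (\<lambda>u. (\<lambda>v. P (pfst v) (psnd v)) (prod_encode (u, 0)))"
    by (intro semidecidable_comp[OF 0(1)] recursive_intros)
  then show ?case by simp
next
  case (Suc d)
  let ?P = "\<lambda>u w. P (pfst u) (Suc (prod_encode (psnd u, w)))"
  have "semidecidable (\<lambda>v. (\<lambda>v. P (pfst v) (psnd v))
     (prod_encode (pfst (pfst v), Suc (prod_encode (psnd (pfst v), psnd v)))))"
    by (intro semidecidable_comp[OF Suc.prems(1)] recursive_intros)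
  then have "semidecidable (\<lambda>v. ?P (pfst v) (psnd v))" by simp
  from Suc.IH[OF this, of "\<lambda>v. n (pfst v)"]
  have "semidecidable (\<lambda>u. \<forall>xs. length xs = d \<and> (\<forall>x\<in>set xs. x < n (pfst u)) \<longrightarrow> ?P u (list_encode xs))"
    by (simp add: total_recursive_comp[OF Suc.prems(2)] recursive_intros)
  then have "semidecidable (\<lambda>u. \<forall>i<n u. \<forall>xs. length xs = d \<and> (\<forall>x\<in>set xs. x < n u) \<longrightarrow>
      P u (Suc (prod_encode (i, list_encode xs))))"
    by (intro semidecidable_all_less Suc.prems(2)) simp
  moreover have "(\<forall>i<n u. \<forall>xs. length xs = d \<and> (\<forall>x\<in>set xs. x < n u) \<longrightarrow>
      P u (Suc (prod_encode (i, list_encode xs)))) \<longleftrightarrow>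
    (\<forall>xs. length xs = Suc d \<and> (\<forall>x\<in>set xs. x < n u) \<longrightarrow> P u (list_encode xs))"
    (is "?l \<longleftrightarrow> ?r") for u
  proof
    assume ?r
    then show ?l by (metis length_Cons list_encode.simps(2) set_ConsD)
  qed (auto simp: length_Suc_conv)
  ultimately show ?case by simp
qed

section \<open>Rational arithmetic\<close>

text \<open>A difference of naturals over a successor avoids signs, division by zero and reduction
  to lowest terms; each arithmetic operation is polynomial in the three components.\<close>

definition computable_rat :: "(nat \<Rightarrow> real) \<Rightarrow> bool" where
  "computable_rat r \<longleftrightarrow> (\<exists>p n d. total_recursive p \<and> total_recursive n \<and> total_recursive d \<and>
     (\<forall>u. r u = (real (p u) - real (n u)) / real (Suc (d u))))"

lemma computable_ratI:
  assumes "total_recursive p" "total_recursive n" "total_recursive d"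
    "\<And>u. r u = (real (p u) - real (n u)) / real (Suc (d u))"
  shows "computable_rat r"
  using assms unfolding computable_rat_def by blast

lemma computable_ratE:
  assumes "computable_rat r"
  obtains p n d where "total_recursive p" "total_recursive n" "total_recursive d"
    "r = (\<lambda>u. (real (p u) - real (n u)) / real (Suc (d u)))"
  using assms unfolding computable_rat_def by blast

lemma computable_rat_of_nat [recursive_intros]:
  "total_recursive f \<Longrightarrow> computable_rat (\<lambda>u. real (f u))"
  by (rule computable_ratI[of f "\<lambda>u. 0" "\<lambda>u. 0"]) (auto intro: recursive_intros)

lemma computable_rat_const [recursive_intros]:
  "computable_rat (\<lambda>u. 0)" "computable_rat (\<lambda>u. 1)" "computable_rat (\<lambda>u. numeral c)"
  using computable_rat_of_nat[OF total_recursive_const[of 0]]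
    computable_rat_of_nat[OF total_recursive_const[of 1]]
    computable_rat_of_nat[OF total_recursive_const[of "numeral c"]] by auto

lemma computable_rat_uminus [recursive_intros]:
  "computable_rat r \<Longrightarrow> computable_rat (\<lambda>u. - r u)"
  by (erule computable_ratE, rule computable_ratI[where p = "_" and n = "_"])
    (auto simp: minus_divide_left)

lemma computable_rat_add [recursive_intros]:
  assumes "computable_rat r" "computable_rat s"
  shows "computable_rat (\<lambda>u. r u + s u)"
proof -
  from assms(1) obtain p n d where r: "total_recursive p" "total_recursive n" "total_recursive d"
    "r = (\<lambda>u. (real (p u) - real (n u)) / real (Suc (d u)))" by (rule computable_ratE)
  from assms(2) obtain p' n' d' where s: "total_recursive p'" "total_recursive n'" "total_recursive d'"
    "s = (\<lambda>u. (real (p' u) - real (n' u)) / real (Suc (d' u)))" by (rule computable_ratE)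
  show ?thesis
  proof (rule computable_ratI)
    show "total_recursive (\<lambda>u. p u * Suc (d' u) + p' u * Suc (d u))"
      "total_recursive (\<lambda>u. n u * Suc (d' u) + n' u * Suc (d u))"
      "total_recursive (\<lambda>u. Suc (d u) * Suc (d' u) - 1)"
      by (intro recursive_intros r s)+
    fix u
    have *: "real (Suc (Suc (d u) * Suc (d' u) - 1)) = real (Suc (d u)) * real (Suc (d' u))"
      by (simp del: of_nat_Suc flip: of_nat_mult)
    show "r u + s u = (real (p u * Suc (d' u) + p' u * Suc (d u)) -
        real (n u * Suc (d' u) + n' u * Suc (d u))) / real (Suc (Suc (d u) * Suc (d' u) - 1))"
      unfolding * r(4) s(4) of_nat_add of_nat_mult
      by (simp add: divide_simps del: of_nat_Suc) (simp add: algebra_simps del: of_nat_Suc)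
  qed
qed

lemma computable_rat_diff [recursive_intros]:
  "computable_rat r \<Longrightarrow> computable_rat s \<Longrightarrow> computable_rat (\<lambda>u. r u - s u)"
  using computable_rat_add[OF _ computable_rat_uminus, of r s] by simp

lemma computable_rat_mult [recursive_intros]:
  assumes "computable_rat r" "computable_rat s"
  shows "computable_rat (\<lambda>u. r u * s u)"
proof -
  from assms(1) obtain p n d where r: "total_recursive p" "total_recursive n" "total_recursive d"
    "r = (\<lambda>u. (real (p u) - real (n u)) / real (Suc (d u)))" by (rule computable_ratE)
  from assms(2) obtain p' n' d' where s: "total_recursive p'" "total_recursive n'" "total_recursive d'"
    "s = (\<lambda>u. (real (p' u) - real (n' u)) / real (Suc (d' u)))" by (rule computable_ratE)
  show ?thesis
  proof (rule computable_ratI)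
    show "total_recursive (\<lambda>u. p u * p' u + n u * n' u)"
      "total_recursive (\<lambda>u. p u * n' u + n u * p' u)"
      "total_recursive (\<lambda>u. Suc (d u) * Suc (d' u) - 1)"
      by (intro recursive_intros r s)+
    fix u
    have *: "real (Suc (Suc (d u) * Suc (d' u) - 1)) = real (Suc (d u)) * real (Suc (d' u))"
      by (simp del: of_nat_Suc flip: of_nat_mult)
    show "r u * s u = (real (p u * p' u + n u * n' u) -
        real (p u * n' u + n u * p' u)) / real (Suc (Suc (d u) * Suc (d' u) - 1))"
      unfolding * r(4) s(4) of_nat_add of_nat_mult
      by (simp add: algebra_simps del: of_nat_Suc)
  qed
qed

lemma computable_rat_sum [recursive_intros]:
  assumes "\<And>i. i \<in> A \<Longrightarrow> computable_rat (r i)"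
  shows "computable_rat (\<lambda>u. \<Sum>i\<in>A. r i u)"
  using assms by (induction A rule: infinite_finite_induct) (auto intro: recursive_intros)

lemma computable_rat_half [recursive_intros]:
  assumes "total_recursive k"
  shows "computable_rat (\<lambda>u. (1/2) ^ k u)"
  by (rule computable_ratI[of "\<lambda>u. 1" "\<lambda>u. 0" "\<lambda>u. 2 ^ k u - 1"])
    (auto intro!: recursive_intros assms simp: power_one_over of_nat_diff)

lemma decidable_rat_le [recursive_intros]:
  assumes "computable_rat r" "computable_rat s"
  shows "decidable (\<lambda>u. r u \<le> s u)"
proof -
  from computable_rat_diff[OF assms] obtain p n d where
    r: "total_recursive p" "total_recursive n" "total_recursive d"
    "(\<lambda>u. r u - s u) = (\<lambda>u. (real (p u) - real (n u)) / real (Suc (d u)))"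
    by (rule computable_ratE)
  have "r u \<le> s u \<longleftrightarrow> p u \<le> n u" for u
    using fun_cong[OF r(4), of u] by (smt (verit) divide_le_0_iff of_nat_0_less_iff of_nat_le_iff zero_less_Suc)
  then show ?thesis by (simp add: decidable_le r)
qed

lemma decidable_rat_less [recursive_intros]:
  "computable_rat r \<Longrightarrow> computable_rat s \<Longrightarrow> decidable (\<lambda>u. r u < s u)"
  using decidable_not[OF decidable_rat_le] by (simp add: not_le)

lemma decidable_odd [recursive_intros]:
  assumes "total_recursive f"
  shows "decidable (\<lambda>u. odd (f u))"
proof -
  have e: "rec_nat 0 (\<lambda>k y. Suc 0 - y) n = (of_bool (odd n) :: nat)" for n :: nat
    by (induction n) auto
  have "total_recursive (\<lambda>u. rec_nat 0 (\<lambda>k y. Suc 0 - y) (f u))"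
    by (intro recursive_intros assms)
  then show ?thesis unfolding decidable_def by (simp add: e)
qed

lemma total_recursive_div2 [recursive_intros]:
  assumes "total_recursive f"
  shows "total_recursive (\<lambda>u. f u div 2)"
proof -
  have h: "rec_nat 0 (\<lambda>k y. if odd k then Suc y else y) n = n div 2" for n :: nat
    by (induction n) auto
  have "total_recursive (\<lambda>u. rec_nat 0 (\<lambda>k y. if odd k then Suc y else y) (f u))"
    by (intro recursive_intros assms)
  then show ?thesis by (simp add: h)
qed

lemma computable_rat_qdec [recursive_intros]:
  assumes "total_recursive f"
  shows "computable_rat (\<lambda>u. qdec (f u))"
proof (rule computable_ratI)
  let ?a = "\<lambda>u. pfst (f u)"
  \<comment> \<open>\<open>int_decode\<close> sends an even code \<open>2 * k\<close> to
    \<open>k\<close> and an odd code \<open>2 * k + 1\<close> to \<open>- k - 1\<close>.\<close>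
  show "total_recursive (\<lambda>u. if odd (?a u) then 0 else ?a u div 2)"
    "total_recursive (\<lambda>u. if odd (?a u) then Suc (?a u div 2) else 0)"
    "total_recursive (\<lambda>u. psnd (f u))"
    by (intro recursive_intros assms)+
  show "qdec (f u) = (real (if odd (?a u) then 0 else ?a u div 2) -
    real (if odd (?a u) then Suc (?a u div 2) else 0)) / real (Suc (psnd (f u)))" for u
    by (auto simp: qdec_def int_decode_def sum_decode_def split: prod.split)
qed

lemma qdec_surj_rat: "x \<in> \<rat> \<Longrightarrow> \<exists>k. qdec k = x"
proof -
  assume "x \<in> \<rat>"
  then obtain a b where ab: "b > 0" "x = of_int a / of_int b" by (rule Rats_cases') auto
  then have "x = of_int a / real (Suc (nat b - 1))" by simp
  then have "qdec (prod_encode (int_encode a, nat b - 1)) = x" by (simp add: qdec_def)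
  then show ?thesis by blast
qed

lemma qdec_between: "x < y \<Longrightarrow> \<exists>k. x < qdec k \<and> qdec k < y"
  using Rats_dense_in_real[of x y] qdec_surj_rat by metis

section \<open>Rational points of a Euclidean space\<close>

lemma basis_enum_bij: "bij_betw (basis_enum :: nat \<Rightarrow> 'a::euclidean_space) {..<DIM('a)} Basis"
proof -
  have "\<exists>e. bij_betw e {..<DIM('a)} (Basis :: 'a set)"
    using ex_bij_betw_nat_finite[OF finite_Basis] by (simp add: lessThan_atLeast0)
  then show ?thesis unfolding basis_enum_def by (rule someI_ex)
qed

lemma basis_enum_in_Basis [simp]: "i < DIM('a) \<Longrightarrow> (basis_enum i :: 'a::euclidean_space) \<in> Basis"
  using basis_enum_bij[where 'a='a] by (auto simp: bij_betw_def)

lemma basis_enum_image: "(basis_enum :: nat \<Rightarrow> 'a::euclidean_space) ` {..<DIM('a)} = Basis"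
  using basis_enum_bij[where 'a='a] by (simp add: bij_betw_def)

lemma inner_basis_enum:
  "i < DIM('a) \<Longrightarrow> j < DIM('a) \<Longrightarrow>
    (basis_enum i :: 'a::euclidean_space) \<bullet> basis_enum j = (if i = j then 1 else 0)"
  using basis_enum_bij[where 'a='a]
  by (auto simp: inner_Basis bij_betw_def inj_on_def)

lemma sum_Basis_enum: "(\<Sum>b\<in>Basis. f (b :: 'a::euclidean_space)) = (\<Sum>i<DIM('a). f (basis_enum i))"
  using sum.reindex_bij_betw[OF basis_enum_bij, of f] by simp

lemma inner_sum_basis_enum:
  "j < DIM('a) \<Longrightarrow> (\<Sum>i<DIM('a). g i *\<^sub>R basis_enum i :: 'a::euclidean_space) \<bullet> basis_enum j = g j"
  by (simp add: inner_sum_left inner_basis_enum if_distrib[where f = "\<lambda>x. g _ * x"] cong: if_cong)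

lemma qpoint_inner: "i < DIM('a) \<Longrightarrow> (qpoint k :: 'a::euclidean_space) \<bullet> basis_enum i = qdec (lnth k i)"
  unfolding qpoint_def by (rule inner_sum_basis_enum)

lemma qpoint_near:
  fixes x :: "'a::euclidean_space"
  assumes "e > 0"
  shows "\<exists>k. dist (qpoint k) x < e"
proof -
  \<comment> \<open>The error per coordinate that adds up to \<open>e\<close> when the norm is
    bounded by the sum of the coordinates.\<close>
  define d where "d = e / real DIM('a)"
  have d: "d > 0" using assms by (simp add: d_def)
  have "\<exists>k. dist (qdec k) (x \<bullet> basis_enum i) < d" for i
  proof -
    obtain k where "x \<bullet> basis_enum i - d < qdec k" "qdec k < x \<bullet> basis_enum i + d"
      using qdec_between[of "x \<bullet> basis_enum i - d" "x \<bullet> basis_enum i + d"] d by auto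
    then show ?thesis by (intro exI[of _ k]) (simp add: dist_real_def abs_less_iff)
  qed
  then obtain K where K: "\<And>i. dist (qdec (K i)) (x \<bullet> basis_enum i) < d" by metis
  define k where "k = list_encode (map K [0..<DIM('a)])"
  have k: "(qpoint k - x) \<bullet> basis_enum i = qdec (K i) - x \<bullet> basis_enum i" if "i < DIM('a)" for i
    using that by (simp add: inner_diff_left qpoint_inner k_def nth_default_def)
  have "norm (qpoint k - x) \<le> (\<Sum>b\<in>Basis. \<bar>(qpoint k - x) \<bullet> b\<bar>)" by (rule norm_le_l1)
  also have "\<dots> = (\<Sum>i<DIM('a). \<bar>qdec (K i) - x \<bullet> basis_enum i\<bar>)"
    by (simp add: sum_Basis_enum k)
  also have "\<dots> < (\<Sum>i<DIM('a). d)"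
    by (rule sum_strict_mono) (use K in \<open>auto simp: dist_real_def lessThan_empty_iff\<close>)
  also have "\<dots> = e" by (simp add: d_def)
  finally show ?thesis by (auto simp: dist_norm)
qed

definition computable_point :: "(nat \<Rightarrow> 'a::euclidean_space) \<Rightarrow> bool" where
  "computable_point P \<longleftrightarrow> (\<forall>i<DIM('a). computable_rat (\<lambda>u. P u \<bullet> basis_enum i))"

lemma computable_rat_inner [recursive_intros]:
  "computable_point (P :: nat \<Rightarrow> 'a::euclidean_space) \<Longrightarrow> i < DIM('a) \<Longrightarrow> computable_rat (\<lambda>u. P u \<bullet> basis_enum i)"
  by (simp add: computable_point_def)

lemma computable_point_qpoint [recursive_intros]:
  "total_recursive f \<Longrightarrow> computable_point (\<lambda>u. qpoint (f u))"
  by (simp add: computable_point_def qpoint_inner) (intro allI impI recursive_intros)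

lemma computable_point_basis_enum [recursive_intros]:
  "i < DIM('a) \<Longrightarrow> computable_point (\<lambda>u. basis_enum i :: 'a::euclidean_space)"
  by (auto simp: computable_point_def inner_basis_enum intro: recursive_intros)

lemma computable_point_add [recursive_intros]:
  "computable_point P \<Longrightarrow> computable_point Q \<Longrightarrow> computable_point (\<lambda>u. P u + Q u)"
  by (auto simp: computable_point_def inner_add_left intro: recursive_intros)

lemma computable_point_diff [recursive_intros]:
  "computable_point P \<Longrightarrow> computable_point Q \<Longrightarrow> computable_point (\<lambda>u. P u - Q u)"
  by (auto simp: computable_point_def inner_diff_left intro: recursive_intros)

lemma computable_point_scaleR [recursive_intros]:
  "computable_rat r \<Longrightarrow> computable_point P \<Longrightarrow> computable_point (\<lambda>u. r u *\<^sub>R P u)"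
  by (auto simp: computable_point_def intro: recursive_intros)

lemma computable_point_sum [recursive_intros]:
  "(\<And>i. i \<in> A \<Longrightarrow> computable_point (P i)) \<Longrightarrow> computable_point (\<lambda>u. \<Sum>i\<in>A. P i u)"
  by (auto simp: computable_point_def inner_sum_left intro: recursive_intros)

text \<open>Squaring both sides leaves only sums and products of rationals; the separate test
  \<open>0 \<le> r u\<close> restores the sign that squaring forgets.\<close>

lemma decidable_norm_le [recursive_intros]:
  fixes P :: "nat \<Rightarrow> 'a::euclidean_space"
  assumes "computable_point P" "computable_rat r"
  shows "decidable (\<lambda>u. norm (P u) \<le> r u)"
proof -
  have "decidable (\<lambda>u. 0 \<le> r u \<and> (\<Sum>i<DIM('a). (P u \<bullet> basis_enum i) * (P u \<bullet> basis_enum i)) \<le> r u * r u)"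
    by (intro recursive_intros assms) simp_all
  moreover have "(0 \<le> r u \<and> (\<Sum>i<DIM('a). (P u \<bullet> basis_enum i) * (P u \<bullet> basis_enum i)) \<le> r u * r u)
    \<longleftrightarrow> norm (P u) \<le> r u" for u
  proof -
    have "(\<Sum>i<DIM('a). (P u \<bullet> basis_enum i) * (P u \<bullet> basis_enum i)) = (norm (P u))\<^sup>2"
      by (simp add: power2_norm_eq_inner euclidean_inner[of "P u" "P u"] sum_Basis_enum)
    then show ?thesis
      by (metis norm_ge_zero order_trans power2_eq_square power_mono power2_le_imp_le)
  qed
  ultimately show ?thesis by simp
qed

lemma decidable_dist_le [recursive_intros]:
  "computable_point P \<Longrightarrow> computable_point Q \<Longrightarrow> computable_rat r \<Longrightarrow> decidable (\<lambda>u. dist (P u) (Q u) \<le> r u)"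
  unfolding dist_norm by (intro recursive_intros)

lemma decidable_dist_ge [recursive_intros]:
  assumes "computable_point P" "computable_point Q" "computable_rat r"
  shows "decidable (\<lambda>u. r u < dist (P u) (Q u))"
  using decidable_not[OF decidable_dist_le[OF assms]] by (simp add: not_le)

section \<open>Enclosures of images of rational balls\<close>

lemmas [recursive_intros] =
  semidecidable_decidable[OF decidable_eq]
  semidecidable_decidable[OF decidable_length_le]
  semidecidable_decidable[OF decidable_rat_le]
  semidecidable_decidable[OF decidable_rat_less]
  semidecidable_decidable[OF decidable_norm_le]
  semidecidable_decidable[OF decidable_dist_le]
  semidecidable_decidable[OF decidable_dist_ge]

abbreviation bctr :: "nat \<Rightarrow> 'a::euclidean_space" where "bctr c \<equiv> qpoint (pfst c)"
abbreviation brad :: "nat \<Rightarrow> real" where "brad c \<equiv> qdec (psnd c)"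
abbreviation bball :: "nat \<Rightarrow> 'a::euclidean_space set" where "bball c \<equiv> ball (bctr c) (brad c)"

text \<open>This inequality between codes is decidable and stands in for inclusion of balls in the
  certificates below.\<close>

lemma bball_subset:
  "dist (bctr c :: 'a::euclidean_space) (bctr b) \<le> brad b - brad c \<Longrightarrow> (bball c :: 'a set) \<subseteq> bball b"
  by (simp add: ball_subset_ball_iff)

lemma bball_near:
  fixes x :: "'a::euclidean_space"
  assumes "e > 0" "l < u"
  obtains c where "dist (bctr c) x < e" "l < brad c" "brad c < u"
proof -
  obtain i j where "dist (qpoint i) x < e" "l < qdec j" "qdec j < u"
    using qpoint_near[OF assms(1), of x] qdec_between[OF assms(2)] by blast
  then show ?thesis by (intro that[of "prod_encode (i, j)"]) auto
qed

text \<open>Entries twice as accurate as required leave a slack of \<open>(1/2) ^ Suc k\<close> at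
  position \<open>k\<close>, so a finite prefix is still consistent with every point close enough to
  \<open>x\<close>.\<close>

lemma rho_name_fast:
  fixes x :: "'a::euclidean_space"
  obtains p where "\<And>k. dist (qpoint (p k)) x \<le> (1/2) ^ Suc k" "rho_name p x"
proof -
  have "\<exists>j. dist (qpoint j) x < (1/2) ^ Suc k" for k
    by (rule qpoint_near) simp
  then obtain p where p: "\<And>k. dist (qpoint (p k)) x < (1/2) ^ Suc k" by metis
  have "dist (qpoint (p k)) x \<le> (1/2) ^ k" for k
    using p[of k] by (simp add: field_simps)
  then show ?thesis using p by (intro that[of p]) (auto simp: rho_name_def less_imp_le)
qed

lemma list_decode_prefix_code: "list_decode (prefix_code p m) = map p [0..<m]"
  by (simp add: prefix_code_def)

text \<open>The last clause does not claim \<open>I b c\<close> for every pair with the inclusion.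
  It asks for all small balls near \<open>x\<close> at once, with no lower bound on their radius,
  and this uniformity is what compactness arguments can exploit.\<close>

definition enclosure_relation ::
  "'a::euclidean_space set \<Rightarrow> ('a \<Rightarrow> 'b::euclidean_space) \<Rightarrow> (nat \<Rightarrow> nat \<Rightarrow> bool) \<Rightarrow> bool" where
  "enclosure_relation X f I \<longleftrightarrow> semidecidable (\<lambda>u. I (pfst u) (psnd u)) \<and>
    (\<forall>b c. I b c \<longrightarrow> f ` (bball b \<inter> X) \<subseteq> bball c) \<and>
    (\<forall>x c. x \<in> X \<and> f x \<in> bball c \<longrightarrow> (\<exists>e>0. \<forall>b. dist (bctr b) x + brad b < e \<longrightarrow> I b c))"

lemma semidecidable_enclosure:
  assumes "enclosure_relation X f I" "total_recursive g" "total_recursive h"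
  shows "semidecidable (\<lambda>u. I (g u) (h u))"
proof -
  have "semidecidable (\<lambda>u. I (pfst u) (psnd u))"
    using assms(1) by (simp add: enclosure_relation_def)
  from semidecidable_comp[OF this total_recursive_prod_encode[OF assms(2,3)]]
  show ?thesis by simp
qed

lemma enclosureD:
  "enclosure_relation X f I \<Longrightarrow> I b c \<Longrightarrow> x \<in> bball b \<Longrightarrow> x \<in> X \<Longrightarrow> f x \<in> bball c"
  unfolding enclosure_relation_def by blast

lemma enclosure_near:
  assumes "enclosure_relation X f I" "x \<in> X" "f x \<in> bball c"
  obtains e where "e > 0" "\<And>b. dist (bctr b) x + brad b < e \<Longrightarrow> I b c"
  using assms unfolding enclosure_relation_def by blast

text \<open>A finite prefix of a name that is consistent with every point of a ball yields an output
  approximation valid for all these points at once, since it extends to a name of each of them.\<close>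

lemma computable_on_enclosure:
  fixes f :: "'a::euclidean_space \<Rightarrow> 'b::euclidean_space"
  assumes "computable_on X f"
  shows "\<exists>I. enclosure_relation X f I"
proof -
  obtain F e where e: "total_recursive e"
    and ex: "\<And>p x n. x \<in> X \<Longrightarrow> rho_name p x \<Longrightarrow> \<exists>m. e (prod_encode (prefix_code p m, n)) \<noteq> 0"
    and eq: "\<And>p x n m. x \<in> X \<Longrightarrow> rho_name p x \<Longrightarrow> e (prod_encode (prefix_code p m, n)) \<noteq> 0 \<Longrightarrow>
             e (prod_encode (prefix_code p m, n)) = Suc (F p n)"
    and F: "\<And>p x. x \<in> X \<Longrightarrow> rho_name p x \<Longrightarrow> rho_name (F p) (f x)"
    using assms unfolding computable_on_def type2_computable_def by blast
  \<comment> \<open>The entries of \<open>w\<close> fit every point of \<open>b\<close>, and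
    \<open>v\<close> is the output symbol at position \<open>n\<close> obtained from
    \<open>w\<close>. The margin \<open>2 * (1/2) ^ n\<close> exceeds the output error
    \<open>(1/2) ^ n\<close>, which puts \<open>f x\<close> strictly inside the open ball. Positions
    between the end of \<open>w\<close> and \<open>m\<close> read as 0 and only strengthen the
    condition.\<close>
  define I where "I b c \<longleftrightarrow> (\<exists>w m n v. length (list_decode w) \<le> m \<and>
    (\<forall>k<m. dist (qpoint (lnth w k) :: 'a) (bctr b) \<le> (1/2) ^ k - brad b) \<and>
    e (prod_encode (w, n)) = Suc v \<and> dist (qpoint v :: 'b) (bctr c) \<le> brad c - 2 * (1/2) ^ n)" for b c
  have "enclosure_relation X f I"
    unfolding enclosure_relation_def
  proof (intro conjI allI impI, goal_cases)
    case 1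
    show ?case unfolding I_def
      by (intro recursive_intros total_recursive_comp[OF e])
  next
    case (2 b c)
    then obtain w m n v where w: "length (list_decode w) \<le> m"
      "\<And>k. k < m \<Longrightarrow> dist (qpoint (lnth w k) :: 'a) (bctr b) \<le> (1/2) ^ k - brad b"
      "e (prod_encode (w, n)) = Suc v" "dist (qpoint v :: 'b) (bctr c) \<le> brad c - 2 * (1/2) ^ n"
      unfolding I_def by blast
    show ?case
    proof safe
      fix x :: 'a assume x: "x \<in> bball b" "x \<in> X"
      \<comment> \<open>Beyond the prefix any name of \<open>x\<close> will do; the name
        \<open>p\<close> below is \<open>w\<close> continued by \<open>q\<close>.\<close>
      obtain q where q: "rho_name q x" using rho_name_fast by blast
      define l where "l = length (list_decode w)"
      define p where "p k = (if k < l then lnth w k else q k)" for k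
      have "map p [0..<l] = list_decode w"
        by (rule nth_equalityI) (auto simp: p_def l_def nth_default_def)
      then have pw: "prefix_code p l = w" by (simp add: prefix_code_def)
      have "dist (qpoint (p k)) x \<le> (1/2) ^ k" for k
      proof (cases "k < l")
        case True
        then have "dist (qpoint (p k)) (bctr b :: 'a) \<le> (1/2) ^ k - brad b"
          using w(1) w(2)[of k] by (simp add: p_def l_def)
        then show ?thesis using x(1) dist_triangle[of "qpoint (p k)" x "bctr b"] by auto
      qed (use q in \<open>auto simp: p_def rho_name_def\<close>)
      then have p: "rho_name p x" by (simp add: rho_name_def)
      have "F p n = v" using eq[OF x(2) p, of l n] by (simp add: pw w(3))
      then have "dist (qpoint v) (f x) \<le> (1/2) ^ n"
        using F[OF x(2) p] by (auto simp: rho_name_def)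
      moreover define t :: real where "t = (1/2) ^ n"
      ultimately have "dist (bctr c) (f x) < brad c"
        using w(4) dist_triangle3[of "bctr c" "f x" "qpoint v"]
        unfolding t_def[symmetric] by (smt (verit) t_def half_gt_zero zero_less_one zero_less_power)
      then show "f x \<in> bball c" by simp
    qed
  next
    case (3 x c)
    then have x: "x \<in> X" "f x \<in> bball c" by auto
    obtain p where p: "\<And>k. dist (qpoint (p k)) x \<le> (1/2) ^ Suc k" "rho_name p x"
      using rho_name_fast by blast
    \<comment> \<open>Three output errors fit into the gap: one for the distance of the output to
      \<open>f x\<close>, two for the margin that \<open>I\<close> demands.\<close>
    obtain n where n: "(1/2) ^ n < (brad c - dist (bctr c) (f x)) / 3"
      using real_arch_pow_inv[of "(brad c - dist (bctr c) (f x)) / 3" "1/2"] x(2) by auto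
    obtain m where m: "e (prod_encode (prefix_code p m, n)) \<noteq> 0" using ex[OF x(1) p(2)] by blast
    define h :: real where "h = (1/2) ^ n"
    have h: "dist (qpoint (F p n)) (f x) \<le> h"
      using F[OF x(1) p(2)] by (auto simp: rho_name_def h_def)
    have h': "h < (brad c - dist (bctr c) (f x)) / 3" using n by (simp add: h_def)
    have "D \<le> r - 2 * h" if "d \<le> h" "h < (r - d') / 3" "D \<le> d + d'" for D r d d' :: real
      using that by simp
    from this[OF h h' dist_triangle2]
    have v: "dist (qpoint (F p n) :: 'b) (bctr c) \<le> brad c - 2 * h" .
    \<comment> \<open>A lower bound for the slack \<open>(1/2) ^ Suc k\<close> of all entries
      \<open>k < m\<close> that were read.\<close>
    define t :: real where "t = (1/2) ^ Suc m"
    show ?case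
    proof (rule exI[of _ t], intro conjI allI impI)
      show "0 < t" by (simp add: t_def)
      fix b :: nat assume b: "dist (bctr b) x + brad b < t"
      have "dist (qpoint (lnth (prefix_code p m) k)) (bctr b :: 'a) \<le> (1/2) ^ k - brad b"
        if k: "k < m" for k
      proof -
        have "lnth (prefix_code p m) k = p k"
          using k by (simp add: list_decode_prefix_code nth_default_def)
        moreover define h :: real where "h = (1/2) ^ Suc k"
        moreover have "t \<le> h" unfolding t_def h_def
          using k by (intro power_decreasing) auto
        moreover have "(1/2) ^ k = 2 * h" by (simp add: h_def)
        moreover have "dist (qpoint (p k)) x \<le> h" using p(1)[of k] by (simp add: h_def)
        ultimately show ?thesis
          using b dist_triangle2[of "qpoint (p k)" "bctr b" x] by (simp add: dist_commute)
      qed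
      then show "I b c" unfolding I_def
        using eq[OF x(1) p(2) m] v[unfolded h_def]
        by (intro exI[of _ "prefix_code p m"] exI[of _ m] exI[of _ n] exI[of _ "F p n"])
          (simp add: list_decode_prefix_code)
    qed
  qed
  then show ?thesis by blast
qed

lemma computable_on_subset: "computable_on X f \<Longrightarrow> Y \<subseteq> X \<Longrightarrow> computable_on Y f"
  unfolding computable_on_def type2_computable_def by blast

lemma computable_on_continuous_on:
  fixes f :: "'a::euclidean_space \<Rightarrow> 'b::euclidean_space"
  assumes "computable_on X f"
  shows "continuous_on X f"
  unfolding continuous_on_iff
proof (intro ballI allI impI)
  obtain I where I: "enclosure_relation X f I"
    using computable_on_enclosure[OF assms] by blast
  fix x and e :: real assume x: "x \<in> X" and e: "e > 0"
  obtain c where c: "dist (bctr c) (f x) < e / 4" "e / 4 < brad c" "brad c < e / 2"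
    by (rule bball_near[of "e/4" "e/4" "e/2" "f x"]) (use e in auto)
  then obtain d where d: "d > 0" "\<And>b. dist (bctr b) x + brad b < d \<Longrightarrow> I b c"
    using enclosure_near[OF I x, of c] by auto
  \<comment> \<open>A radius above \<open>d / 4\<close> and a centre within \<open>d / 8\<close> of
    \<open>x\<close> make \<open>b\<close> contain the \<open>d / 8\<close>-ball about
    \<open>x\<close>, while \<open>b\<close> is still small enough for \<open>I b c\<close>.\<close>
  obtain b where b: "dist (bctr b) x < d / 8" "d / 4 < brad b" "brad b < d / 2"
    by (rule bball_near[of "d/8" "d/4" "d/2" x]) (use d in auto)
  have Ib: "I b c" using b d(1) by (intro d(2)) linarith
  show "\<exists>d>0. \<forall>x'\<in>X. dist x' x < d \<longrightarrow> dist (f x') (f x) < e"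
  proof (intro exI conjI ballI impI)
    show "d / 8 > 0" using d by simp
    fix y assume y: "y \<in> X" "dist y x < d / 8"
    have "dist (bctr b) y < brad b"
      using dist_triangle2[of "bctr b" y x] y b d by linarith
    then have "f y \<in> bball c" using enclosureD[OF I Ib] y by auto
    then show "dist (f y) (f x) < e"
      using c e dist_triangle3[of "f y" "f x" "bctr c"] by simp
  qed
qed

text \<open>An output position \<open>n\<close> codes an input position \<open>i\<close>, a
  candidate \<open>c\<close> and a stage \<open>k\<close>; the output is \<open>c\<close> if stage
  \<open>k\<close> confirms \<open>R (p i) c\<close>. Running through all positions dovetails all
  the searches, and each output symbol depends on a single input symbol.\<close>

lemma effectively_openI:
  fixes f :: "'a::euclidean_space \<Rightarrow> 'b::euclidean_space"
  assumes R: "semidecidable (\<lambda>u. R (pfst u) (psnd u))"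
    and sound: "\<And>b c. (bball b :: 'a set) \<subseteq> X \<Longrightarrow> R b c \<Longrightarrow> bball c \<subseteq> f ` bball b"
    and complete: "\<And>b x. bball b \<subseteq> X \<Longrightarrow> x \<in> bball b \<Longrightarrow> \<exists>c. f x \<in> bball c \<and> R b c"
  shows "effectively_open X f"
proof -
  obtain D where D: "decidable D" "\<And>u. R (pfst u) (psnd u) \<longleftrightarrow> (\<exists>k. D (prod_encode (u, k)))"
    using R unfolding semidecidable_def by blast
  have R_iff: "R b c \<longleftrightarrow> (\<exists>k. D (prod_encode (prod_encode (b, c), k)))" for b c
    using D(2)[of "prod_encode (b, c)"] by simp
  \<comment> \<open>A name needs a symbol at every position, so an unconfirmed one yields 0, whose
    radius \<open>qdec 0 = 0\<close> codes the empty ball.\<close>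
  define G where "G b n = (if D (prod_encode (prod_encode (b, pfst (psnd n)), psnd (psnd n)))
    then pfst (psnd n) else 0)" for b n
  define F where "F p n = G (p (pfst n)) n" for p :: "nat \<Rightarrow> nat" and n
  \<comment> \<open>A prefix of length exactly \<open>pfst n\<close> does not yet contain the entry
    at position \<open>pfst n\<close>, hence \<open>\<le>\<close>.\<close>
  define e where "e v = (if length (list_decode (pfst v)) \<le> pfst (psnd v) then 0
    else Suc (G (lnth (pfst v) (pfst (psnd v))) (psnd v)))" for v
  have e: "total_recursive e"
    unfolding e_def[abs_def] G_def
    by (intro recursive_intros decidable_comp[OF D(1)])
  have e_eq: "e (prod_encode (prefix_code p m, n)) = (if m \<le> pfst n then 0 else Suc (F p n))" for p m n
    by (simp add: e_def F_def list_decode_prefix_code nth_default_def)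
  have "type2_computable {p. \<exists>U. open U \<and> U \<subseteq> X \<and> theta_name p U} F"
    unfolding type2_computable_def
    by (rule exI[of _ e]) (auto simp: e e_eq not_le split: if_splits)
  moreover have "theta_name (F p) (f ` U)" if U: "U \<subseteq> X" "theta_name p U" for p U
    unfolding theta_name_def
  proof safe
    have U_eq: "U = (\<Union>k. bball (p k))" using U(2) by (simp add: theta_name_def)
    then have sub: "bball (p k) \<subseteq> X" for k using U(1) by blast
    show "f x \<in> (\<Union>k. bball (F p k))" if x: "x \<in> U" for x
    proof -
      obtain i where i: "x \<in> bball (p i)" using x U_eq by blast
      obtain c k where c: "f x \<in> bball c" "D (prod_encode (prod_encode (p i, c), k))"
        using complete[OF sub i] R_iff by blast
      then have "F p (prod_encode (i, prod_encode (c, k))) = c" by (simp add: F_def G_def)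
      then show ?thesis using c(1)
        by (intro UN_I[of "prod_encode (i, prod_encode (c, k))"]) simp_all
    qed
    fix y n assume y: "y \<in> (bball (F p n) :: 'b set)"
    have "D (prod_encode (prod_encode (p (pfst n), pfst (psnd n)), psnd (psnd n)))"
    proof (rule ccontr)
      assume "\<not> ?thesis"
      then have "brad (F p n) = 0"
        by (simp add: F_def G_def prod_decode_0 qdec_def int_decode_def sum_decode_def)
      then show False using y by simp
    qed
    then have "F p n = pfst (psnd n)" "R (p (pfst n)) (F p n)" by (auto simp: F_def G_def R_iff)
    then have "y \<in> f ` bball (p (pfst n))" using sound[OF sub] y by blast
    moreover have "bball (p (pfst n)) \<subseteq> U" unfolding U_eq by (rule UN_upper) simp
    ultimately show "y \<in> f ` U" by (rule rev_subsetD[OF _ image_mono])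
  qed
  ultimately show ?thesis unfolding effectively_open_def by blast
qed

section \<open>Convex images\<close>

lemma bball_inside_near:
  fixes x :: "'a::euclidean_space"
  assumes "x \<in> bball b"
  obtains e where "e > 0" "\<And>c. dist (bctr c) x + brad c < e \<Longrightarrow> dist (bctr c :: 'a) (bctr b) \<le> brad b - brad c"
proof
  show "brad b - dist (bctr b) x > 0" using assms by simp
  show "dist (bctr c :: 'a) (bctr b) \<le> brad b - brad c" if "dist (bctr c) x + brad c < brad b - dist (bctr b) x" for c
    using that dist_triangle2[of "bctr c" "bctr b" x] by simp
qed

text \<open>Makes "the image of \<open>b\<close> meets \<open>c\<close>" searchable: by its positive
  radius \<open>b'\<close> contains its centre, a point of \<open>b\<close> that is mapped into
  \<open>c\<close> if it lies in \<open>X\<close>.\<close>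

lemma enclosure_inside:
  fixes x :: "'a::euclidean_space"
  assumes I: "enclosure_relation X f I" and "x \<in> X" "x \<in> bball b" "f x \<in> bball c"
  obtains b' where "0 < brad b'" "dist (bctr b' :: 'a) (bctr b) \<le> brad b - brad b'" "I b' c"
proof -
  obtain d where d: "d > 0" "\<And>c. dist (bctr c) x + brad c < d \<Longrightarrow> dist (bctr c :: 'a) (bctr b) \<le> brad b - brad c"
    using bball_inside_near[OF assms(3)] by blast
  obtain e where e: "e > 0" "\<And>b. dist (bctr b) x + brad b < e \<Longrightarrow> I b c"
    using enclosure_near[OF I assms(2,4)] by blast
  obtain b' where b': "dist (bctr b') x < min d e / 2" "0 < brad b'" "brad b' < min d e / 2"
    by (rule bball_near[of "min d e / 2" 0 "min d e / 2" x]) (use d e in auto)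
  show ?thesis by (rule that[of b']) (use b' in \<open>auto intro!: d e\<close>)
qed

text \<open>If \<open>y\<close> in the ball were missing from \<open>C\<close>, a functional with
  normal \<open>a\<close> would be at most its value at \<open>y\<close> on all of \<open>C\<close>.
  Some axis \<open>i\<close> carries at least \<open>norm a / DIM('a)\<close> of the normal, so a
  shift by \<open>2 * DIM('a) * t\<close> along \<open>i\<close>, with the right sign, raises the
  functional by at least \<open>2 * t * norm a\<close>. The deviations of \<open>y\<close> and of
  the point of \<open>C\<close> from the two centres cost less than \<open>t * norm a\<close> each,
  a contradiction.\<close>

lemma ball_subset_convex:
  fixes z :: "'a::euclidean_space"
  assumes C: "convex C" and t: "t > 0"
    and meet: "\<And>i s. i \<in> Basis \<Longrightarrow> s \<in> {1, -1} \<Longrightarrow> C \<inter> ball (z + (2 * real DIM('a) * t * s) *\<^sub>R i) t \<noteq> {}"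
  shows "ball z t \<subseteq> C"
proof (rule ccontr)
  assume "\<not> ball z t \<subseteq> C"
  then obtain y where y: "y \<in> ball z t" "y \<notin> C" by blast
  have "C \<noteq> {}" using meet[of "SOME i. i \<in> Basis" 1] nonempty_Basis by (auto simp: some_in_eq)
  then obtain a b where a: "a \<noteq> 0" "\<And>x. x \<in> C \<Longrightarrow> a \<bullet> x \<le> b" "b \<le> a \<bullet> y"
    using separating_hyperplane_sets[OF C, of "{y}"] y(2) by auto
  define M where "M = Max ((\<lambda>i. \<bar>a \<bullet> i\<bar>) ` Basis)"
  have "M \<in> (\<lambda>i. \<bar>a \<bullet> i\<bar>) ` Basis" unfolding M_def by (rule Max_in) auto
  then obtain i where i: "i \<in> Basis" "M = \<bar>a \<bullet> i\<bar>" by blast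
  have "norm a \<le> (\<Sum>i\<in>Basis. \<bar>a \<bullet> i\<bar>)" by (rule norm_le_l1)
  also have "\<dots> \<le> real DIM('a) * M"
    by (rule sum_bounded_above) (simp add: M_def)
  finally have M: "norm a \<le> real DIM('a) * M" .
  define s :: real where "s = (if a \<bullet> i \<ge> 0 then 1 else -1)"
  have s: "s * (a \<bullet> i) = M" "s \<in> {1, -1}" by (auto simp: s_def i(2))
  define q where "q = z + (2 * real DIM('a) * t * s) *\<^sub>R i"
  obtain x where x: "x \<in> C" "x \<in> ball q t" using meet[OF i(1) s(2)] unfolding q_def by blast
  have *: "\<bar>a \<bullet> (v - w)\<bar> < t * norm a" if "v \<in> ball w t" for v w
  proof -
    have "\<bar>a \<bullet> (v - w)\<bar> \<le> norm a * norm (v - w)" by (rule Cauchy_Schwarz_ineq2)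
    also have "\<dots> < norm a * t" using that a(1) by (simp add: dist_norm norm_minus_commute)
    finally show ?thesis by (simp add: mult.commute)
  qed
  have "a \<bullet> q = a \<bullet> z + 2 * real DIM('a) * t * (s * (a \<bullet> i))" by (simp add: q_def inner_add_right)
  also have "\<dots> = a \<bullet> z + 2 * (t * (real DIM('a) * M))" by (simp add: s(1))
  finally have q: "a \<bullet> q \<ge> a \<bullet> z + 2 * (t * norm a)" using M t by simp
  show False
    using *[OF x(2)] *[OF y(1)] q a(2)[OF x(1)] a(3) by (simp add: inner_diff_right)
qed

theorem effectively_open_convex:
  fixes f :: "'a::euclidean_space \<Rightarrow> 'b::euclidean_space"
  assumes comp: "computable_on X f" and op: "open_on X f"
    and conv: "\<And>c r. 0 < r \<Longrightarrow> ball c r \<subseteq> X \<Longrightarrow> convex (f ` ball c r)"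
  shows "effectively_open X f"
proof -
  obtain I where I: "enclosure_relation X f I" using computable_on_enclosure[OF comp] by blast
  let ?q = "\<lambda>i s c. bctr c + (2 * real DIM('b) * brad c * s) *\<^sub>R (basis_enum i :: 'b)"
  define R where "R b c \<longleftrightarrow> 0 < brad c \<and> (\<forall>i\<in>{..<DIM('b)}. \<forall>s\<in>{1, -1}. \<exists>b' c'. 0 < brad b' \<and>
    dist (bctr b' :: 'a) (bctr b) \<le> brad b - brad b' \<and> I b' c' \<and>
    dist (bctr c') (?q i s c) \<le> brad c - brad c')" for b c
  show ?thesis
  proof (rule effectively_openI[of R])
    have s: "computable_rat (\<lambda>u. s)" if "s \<in> {1, -1}" for s
      using that computable_rat_uminus[OF computable_rat_const(2)] by (auto intro: recursive_intros)
    show "semidecidable (\<lambda>u. R (pfst u) (psnd u))"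
      unfolding R_def by (intro recursive_intros semidecidable_enclosure[OF I] s) auto
  next
    fix b c assume b: "(bball b :: 'a set) \<subseteq> X" and R: "R b c"
    obtain b' where "0 < brad b'" "dist (bctr b' :: 'a) (bctr b) \<le> brad b - brad b'"
      using R unfolding R_def by (metis DIM_positive insertI1 lessThan_iff)
    \<comment> \<open>Convexity is assumed for balls of positive radius, and the ball found inside
      \<open>b\<close> shows that \<open>b\<close> is one.\<close>
    then have "brad b > 0" by (smt (verit) zero_le_dist)
    then have C: "convex (f ` bball b)" using conv b by blast
    show "bball c \<subseteq> f ` bball b"
    proof (rule ball_subset_convex[OF C])
      show "0 < brad c" using R by (simp add: R_def)
      fix k :: 'b and s :: real assume k: "k \<in> Basis" and s: "s \<in> {1, -1}"
      obtain i where i: "i < DIM('b)" "k = basis_enum i" using k basis_enum_image by (metis imageE lessThan_iff)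
      obtain b' c' where b': "0 < brad b'" "dist (bctr b' :: 'a) (bctr b) \<le> brad b - brad b'"
        "I b' c'" "dist (bctr c') (?q i s c) \<le> brad c - brad c'"
        using R i(1) s unfolding R_def by blast
      have x: "bctr b' \<in> (bball b :: 'a set)" using b'(1,2) by (simp add: dist_commute)
      have "f (bctr b') \<in> bball c'"
        by (rule enclosureD[OF I b'(3)]) (use x b b'(1) in auto)
      then have "f (bctr b') \<in> ball (?q i s c) (brad c)"
        using b'(4) dist_triangle[of "?q i s c" "f (bctr b')" "bctr c'"] by (simp add: dist_commute)
      then show "f ` bball b \<inter> ball (bctr c + (2 * real DIM('b) * brad c * s) *\<^sub>R k) (brad c) \<noteq> {}"
        using x i(2) by blast
    qed
  next
    fix b and x :: 'a assume b: "bball b \<subseteq> X" and x: "x \<in> bball b"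
    have "open (f ` bball b)" using op b unfolding open_on_def by blast
    then obtain e where e: "e > 0" "ball (f x) e \<subseteq> f ` bball b"
      using x by (meson imageI open_contains_ball)
    \<comment> \<open>Each shifted centre is within \<open>2 * DIM('b) * u\<close> of the centre of
      \<open>c\<close>; one more \<open>u\<close> absorbs the offset of that centre from
      \<open>f x\<close>. So all shifted centres are values of \<open>f\<close> on
      \<open>b\<close>.\<close>
    define u where "u = e / (2 * real DIM('b) + 1)"
    have u: "u > 0" "(2 * real DIM('b) + 1) * u = e" using e(1) by (auto simp: u_def add_pos_pos)
    obtain c where c: "dist (bctr c) (f x) < u / 2" "u / 2 < brad c" "brad c < u"
      by (rule bball_near[of "u/2" "u/2" u "f x"]) (use u in auto)
    have "\<exists>b' c'. 0 < brad b' \<and> dist (bctr b' :: 'a) (bctr b) \<le> brad b - brad b' \<and> I b' c' \<and>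
        dist (bctr c') (?q i s c) \<le> brad c - brad c'" if i: "i < DIM('b)" and s: "s \<in> {1, -1}" for i s
    proof -
      have "dist (?q i s c) (bctr c) = 2 * real DIM('b) * brad c"
        using s i c u by (auto simp: dist_norm abs_mult)
      moreover have "2 * real DIM('b) * brad c + u \<le> e"
      proof -
        have "2 * real DIM('b) * brad c \<le> 2 * real DIM('b) * u" using c by (intro mult_left_mono) auto
        moreover have "2 * real DIM('b) * u + u = e" using u(2) by (simp add: algebra_simps)
        ultimately show ?thesis by linarith
      qed
      ultimately have "?q i s c \<in> ball (f x) e"
        using c dist_triangle[of "f x" "?q i s c" "bctr c"] u(1) by (simp add: dist_commute)
      then obtain x' where x': "x' \<in> bball b" "?q i s c = f x'" using e(2) by blast
      obtain c' where c': "dist (bctr c') (f x') < brad c / 4" "brad c / 4 < brad c'" "brad c' < brad c / 2"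
        by (rule bball_near[of "brad c / 4" "brad c / 4" "brad c / 2" "f x'"]) (use c u in auto)
      obtain b' where "0 < brad b'" "dist (bctr b' :: 'a) (bctr b) \<le> brad b - brad b'" "I b' c'"
        by (rule enclosure_inside[OF I _ x'(1), of c']) (use x' b c' in auto)
      moreover have "dist (bctr c') (?q i s c) \<le> brad c - brad c'"
        unfolding x'(2) using c' c u by linarith
      ultimately show ?thesis by blast
    qed
    then have "R b c" unfolding R_def using c u(1) by auto
    then show "\<exists>c. f x \<in> bball c \<and> R b c" using c by (intro exI[of _ c]) auto
  qed
qed

corollary effectively_open_real:
  fixes f :: "'a::euclidean_space \<Rightarrow> real"
  assumes "computable_on X f" "open_on X f"
  shows "effectively_open X f"
proof (rule effectively_open_convex[OF assms])
  fix c :: 'a and r :: real assume "ball c r \<subseteq> X"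
  then have "connected (f ` ball c r)"
    by (meson assms(1) computable_on_continuous_on connected_ball connected_continuous_image continuous_on_subset)
  then show "convex (f ` ball c r)" using is_interval_convex_1 is_interval_connected_1 by blast
qed

corollary effectively_open_affine:
  fixes f :: "'a::euclidean_space \<Rightarrow> 'b::euclidean_space"
  assumes A: "linear A" "f = (\<lambda>x. A x + b)" and surj: "surj f" and comp: "computable_on UNIV f"
  shows "effectively_open UNIV f"
proof (rule effectively_open_convex[OF comp])
  have img: "f ` S = (\<lambda>y. b + y) ` A ` S" for S by (auto simp: A(2) add.commute)
  have "surj A"
    unfolding surj_def
  proof
    fix y obtain x where "y + b = f x" using surj by (metis surjD)
    then show "\<exists>x. y = A x" by (auto simp: A(2))
  qed
  then show "open_on UNIV f"
    unfolding open_on_def img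
    by (auto intro!: open_translation open_surjective_linear_image[OF _ A(1)])
  show "convex (f ` ball c r)" for c r
    unfolding img by (intro convex_translation convex_linear_image A(1) convex_ball)
qed

section \<open>Locally injective maps\<close>

text \<open>Openness of the image can be checked point by point, so invariance of domain is applied
  on a small ball where \<open>f\<close> is injective.\<close>

lemma open_on_locally_injective:
  fixes f :: "'a::euclidean_space \<Rightarrow> 'a"
  assumes cont: "continuous_on X f" and inj: "\<And>x. x \<in> X \<Longrightarrow> \<exists>r>0. inj_on f (ball x r \<inter> X)"
  shows "open_on X f"
  unfolding open_on_def
proof (intro allI impI)
  fix U assume U: "open U \<and> U \<subseteq> X"
  show "open (f ` U)"
  proof (subst open_subopen, safe)
    fix x assume x: "x \<in> U"
    obtain r where r: "r > 0" "inj_on f (ball x r \<inter> X)" using inj x U by blast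
    have "open (f ` (ball x r \<inter> U))"
      by (rule invariance_of_domain)
        (use U r in \<open>auto intro: continuous_on_subset[OF cont] inj_on_subset[OF r(2)]\<close>)
    then show "\<exists>T. open T \<and> f x \<in> T \<and> T \<subseteq> f ` U"
      using x r(1) by (intro exI[of _ "f ` (ball x r \<inter> U)"]) auto
  qed
qed

text \<open>A Lebesgue number argument. One half of \<open>E p\<close> pays for the way from the
  centre \<open>p\<close> of a covering ball to \<open>q\<close>, the other half for the ball
  \<open>b\<close> near \<open>q\<close>. The inserted 1 keeps the minimum defined when the cover is
  empty.\<close>

lemma compact_uniform_near:
  fixes K :: "'a::euclidean_space set"
  assumes K: "compact K"
    and near: "\<And>q. q \<in> K \<Longrightarrow> \<exists>e>0. \<forall>b. dist (bctr b) q + brad b < e \<longrightarrow> \<Phi> b"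
  obtains e where "e > 0" "\<And>q b. q \<in> K \<Longrightarrow> dist (bctr b) q + brad b < e \<Longrightarrow> \<Phi> b"
proof -
  obtain E where E: "\<And>q. q \<in> K \<Longrightarrow> E q > 0"
    "\<And>q b. q \<in> K \<Longrightarrow> dist (bctr b) q + brad b < E q \<Longrightarrow> \<Phi> b"
    using near by metis
  obtain D where D: "D \<subseteq> K" "finite D" "K \<subseteq> (\<Union>q\<in>D. ball q (E q / 2))"
  proof (rule compactE_image[OF K, of K "\<lambda>q. ball q (E q / 2)"])
    show "K \<subseteq> (\<Union>q\<in>K. ball q (E q / 2))" using E(1) by fastforce
  qed auto
  define e where "e = Min (insert 1 ((\<lambda>q. E q / 2) ` D))"
  show ?thesis
  proof
    show "e > 0" unfolding e_def using D E(1) by (subst Min_gr_iff) auto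
    fix q b assume q: "q \<in> K" and b: "dist (bctr b) q + brad b < e"
    obtain p where p: "p \<in> D" "q \<in> ball p (E p / 2)" using D(3) q by blast
    have "e \<le> E p / 2" unfolding e_def using D(2) p(1) by (intro Min_le) auto
    then have "dist (bctr b) p + brad b < E p"
      using b p(2) dist_triangle[of "bctr b" p q] by (simp add: dist_commute)
    then show "\<Phi> b" using E(2) p(1) D(1) by blast
  qed
qed

text \<open>On \<open>cball a s\<close> each coordinate relative to \<open>a\<close> ranges over an
  interval of length \<open>2 * s\<close>, so rounding it down to the grid of step
  \<open>\<delta>\<close> that starts at \<open>- s\<close> gives an index below \<open>L\<close>.
  Each coordinate is off by less than \<open>\<delta>\<close>, and these errors add up to at most
  the stated distance.\<close>

lemma grid_cover:
  fixes a y :: "'a::euclidean_space"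
  assumes y: "y \<in> cball a s" and d: "\<delta> > 0" and L: "2 * s < \<delta> * real L"
  obtains xs where "length xs = DIM('a)" "\<forall>x\<in>set xs. x < L"
    "dist (a + (\<Sum>i<DIM('a). (\<delta> * real (lnth (list_encode xs) i) - s) *\<^sub>R basis_enum i)) y < real DIM('a) * \<delta>"
proof -
  define t where "t i = (y - a) \<bullet> basis_enum i + s" for i
  have t: "0 \<le> t i" "t i \<le> 2 * s" if "i < DIM('a)" for i
  proof -
    have "\<bar>(y - a) \<bullet> basis_enum i\<bar> \<le> norm (y - a)" using that by (intro Basis_le_norm) simp
    also have "\<dots> \<le> s" using y by (simp add: dist_norm norm_minus_commute)
    finally show "0 \<le> t i" "t i \<le> 2 * s" by (auto simp: t_def)
  qed
  define k where "k i = nat \<lfloor>t i / \<delta>\<rfloor>" for i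
  have k: "\<delta> * real (k i) \<le> t i" "t i < \<delta> * real (k i) + \<delta>" "k i < L" if "i < DIM('a)" for i
  proof -
    have "real (k i) = of_int \<lfloor>t i / \<delta>\<rfloor>" using t[OF that] d by (simp add: k_def)
    then have *: "real (k i) \<le> t i / \<delta>" "t i / \<delta> < real (k i) + 1" by linarith+
    then show **: "\<delta> * real (k i) \<le> t i" "t i < \<delta> * real (k i) + \<delta>"
      using d by (auto simp: field_simps)
    have "\<delta> * real (k i) < \<delta> * real L" using **(1) t(2)[OF that] L by linarith
    then show "k i < L" using d by simp
  qed
  define xs where "xs = map k [0..<DIM('a)]"
  define p where "p = a + (\<Sum>i<DIM('a). (\<delta> * real (lnth (list_encode xs) i) - s) *\<^sub>R basis_enum i)"
  have p: "(p - y) \<bullet> basis_enum i = \<delta> * real (k i) - t i" if "i < DIM('a)" for i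
    using that unfolding p_def
    by (simp add: inner_diff_left inner_add_left inner_sum_basis_enum t_def xs_def nth_default_def)
  have "norm (p - y) \<le> (\<Sum>b\<in>Basis. \<bar>(p - y) \<bullet> b\<bar>)" by (rule norm_le_l1)
  also have "\<dots> = (\<Sum>i<DIM('a). \<bar>\<delta> * real (k i) - t i\<bar>)" by (simp add: sum_Basis_enum p)
  also have "\<dots> < (\<Sum>i<DIM('a). \<delta>)"
  proof (rule sum_strict_mono)
    fix i assume "i \<in> {..<DIM('a)}"
    then show "\<bar>\<delta> * real (k i) - t i\<bar> < \<delta>" using k[of i] by auto
  qed (auto simp: lessThan_empty_iff)
  finally have "dist p y < real DIM('a) * \<delta>" by (simp add: dist_norm)
  then show ?thesis
    unfolding p_def by (intro that[of xs]) (auto simp: xs_def k)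
qed

text \<open>The boundary of \<open>f ` K\<close> lies in the image of the boundary of \<open>K\<close>, so \<open>C\<close> cannot leave \<open>f ` V\<close>.\<close>

lemma ball_subset_image_open_map:
  fixes f :: "'a::euclidean_space \<Rightarrow> 'b::euclidean_space"
  assumes "open_on X f" "continuous_on X f" "V \<subseteq> K" "K \<subseteq> X" "open V" "compact K"
    and away: "f ` (K - V) \<inter> C = {}" and C: "connected C" and meet: "f ` V \<inter> C \<noteq> {}"
  shows "C \<subseteq> f ` V"
proof -
  have "open (f ` V)" using assms(1,3-5) unfolding open_on_def by blast
  moreover have "compact (f ` K)"
    using assms(2,4,6) by (meson compact_continuous_image continuous_on_subset)
  then have "open (- f ` K)" by (simp add: compact_imp_closed open_Compl)
  moreover have "f ` V \<inter> - f ` K \<inter> C = {}" using assms(3) by blast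
  moreover have "C \<subseteq> f ` V \<union> - f ` K" using away by blast
  ultimately have "- f ` K \<inter> C = {}" using connectedD[OF C] meet by blast
  then show ?thesis using away by blast
qed

theorem effectively_open_locally_injective:
  fixes f :: "'a::euclidean_space \<Rightarrow> 'a"
  assumes comp: "computable_on X f" and inj: "\<And>x. x \<in> X \<Longrightarrow> \<exists>r>0. inj_on f (ball x r \<inter> X)"
  shows "effectively_open X f"
proof -
  obtain I where I: "enclosure_relation X f I" using computable_on_enclosure[OF comp] by blast
  have cont: "continuous_on X f" by (rule computable_on_continuous_on[OF comp])
  have op: "open_on X f" by (rule open_on_locally_injective[OF cont inj])
  define d where "d = real DIM('a)"
  \<comment> \<open>A piece \<open>b'\<close> of the cover is harmless if it lies in the core
    \<open>v\<close>, or if its image is certified to miss \<open>c\<close> because the centres are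
    farther apart than the two radii together. The first conjunct keeps everything covered inside
    \<open>b\<close>.\<close>
  define \<Phi> where "\<Phi> b c v b' \<longleftrightarrow> dist (bctr b' :: 'a) (bctr b) \<le> brad b - brad b' \<and>
      (dist (bctr b' :: 'a) (bctr v) \<le> brad v - brad b' \<or>
       (\<exists>c'. I b' c' \<and> brad c + brad c' < dist (bctr c' :: 'a) (bctr c)))" for b c v b'
  define P where "P v s \<delta> w = bctr v +
    (\<Sum>i<DIM('a). (\<delta> * real (lnth w i) - s) *\<^sub>R (basis_enum i :: 'a))" for v s \<delta> w
  \<comment> \<open>The compact set is the closed ball of radius \<open>qdec s\<close> about the
    centre of \<open>v\<close>. Every grid point within \<open>d * qdec \<delta>\<close> of it must
    have its ball of radius \<open>d * qdec \<delta>\<close> inside a harmless \<open>b'\<close>;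
    grid points farther away are excused by a decidable inequality.\<close>
  define R where "R b c \<longleftrightarrow> (\<exists>v s \<delta> L. brad v < qdec s \<and> 0 < qdec \<delta> \<and>
    2 * qdec s < qdec \<delta> * real L \<and>
    (\<exists>b' c'. 0 < brad b' \<and> dist (bctr b' :: 'a) (bctr v) \<le> brad v - brad b' \<and> I b' c' \<and>
      dist (bctr c' :: 'a) (bctr c) \<le> brad c - brad c') \<and>
    (\<forall>xs. length xs = DIM('a) \<and> (\<forall>x\<in>set xs. x < L) \<longrightarrow>
      qdec s + d * qdec \<delta> < dist (P v (qdec s) (qdec \<delta>) (list_encode xs)) (bctr v) \<or>
      (\<exists>b'. dist (P v (qdec s) (qdec \<delta>) (list_encode xs)) (bctr b') \<le> brad b' - d * qdec \<delta> \<and>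
        \<Phi> b c v b')))" for b c
  show ?thesis
  proof (rule effectively_openI[of R])
    show "semidecidable (\<lambda>u. R (pfst u) (psnd u))"
      unfolding R_def \<Phi>_def P_def d_def
      by (intro recursive_intros semidecidable_all_lists semidecidable_enclosure[OF I]) auto
  next
    fix b c assume b: "(bball b :: 'a set) \<subseteq> X" and "R b c"
    then obtain v s \<delta> L b1 c1 where
      vs: "brad v < qdec s" "0 < qdec \<delta>" "2 * qdec s < qdec \<delta> * real L"
      and b1: "0 < brad b1" "dist (bctr b1 :: 'a) (bctr v) \<le> brad v - brad b1" "I b1 c1"
        "dist (bctr c1 :: 'a) (bctr c) \<le> brad c - brad c1"
      and cells: "\<And>xs. length xs = DIM('a) \<Longrightarrow> \<forall>x\<in>set xs. x < L \<Longrightarrow>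
        qdec s + d * qdec \<delta> < dist (P v (qdec s) (qdec \<delta>) (list_encode xs)) (bctr v) \<or>
        (\<exists>b'. dist (P v (qdec s) (qdec \<delta>) (list_encode xs)) (bctr b') \<le> brad b' - d * qdec \<delta> \<and>
          \<Phi> b c v b')"
      unfolding R_def by metis
    have cover: "\<exists>b'. y \<in> bball b' \<and> \<Phi> b c v b'" if y: "y \<in> cball (bctr v) (qdec s)" for y :: 'a
    proof -
      obtain xs where xs: "length xs = DIM('a)" "\<forall>x\<in>set xs. x < L"
        "dist (P v (qdec s) (qdec \<delta>) (list_encode xs)) y < d * qdec \<delta>"
        using grid_cover[OF y vs(2,3)] unfolding P_def d_def by blast
      let ?p = "P v (qdec s) (qdec \<delta>) (list_encode xs)"
      have "\<not> qdec s + d * qdec \<delta> < dist ?p (bctr v)"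
        using y xs(3) dist_triangle[of ?p "bctr v" y] by (simp add: dist_commute)
      then obtain b' where b': "dist ?p (bctr b') \<le> brad b' - d * qdec \<delta>" "\<Phi> b c v b'"
        using cells[OF xs(1,2)] by blast
      then have "y \<in> bball b'"
        using xs(3) dist_triangle[of "bctr b'" y ?p] by (simp add: dist_commute)
      then show ?thesis using b'(2) by blast
    qed
    have sub: "cball (bctr v) (qdec s) \<subseteq> (bball b :: 'a set)"
    proof
      fix y :: 'a assume "y \<in> cball (bctr v) (qdec s)"
      then obtain b' where "y \<in> bball b'" "\<Phi> b c v b'" using cover by blast
      then show "y \<in> bball b" using bball_subset[where 'a='a, of b' b] unfolding \<Phi>_def by blast
    qed
    have "bball c \<subseteq> f ` bball v"
    proof (rule ball_subset_image_open_map[OF op cont])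
      show V: "bball v \<subseteq> cball (bctr v :: 'a) (qdec s)" using vs(1) by auto
      show "cball (bctr v) (qdec s) \<subseteq> X" using sub b by blast
      have "bctr b1 \<in> (bball v :: 'a set)" using b1(1,2) by (simp add: dist_commute)
      moreover from this have "bctr b1 \<in> X" using V sub b by blast
      then have "f (bctr b1) \<in> bball c1" using b1(1) by (intro enclosureD[OF I b1(3)]) auto
      ultimately show "f ` bball v \<inter> bball c \<noteq> {}" using bball_subset[OF b1(4)] by blast
      show "f ` (cball (bctr v) (qdec s) - bball v) \<inter> bball c = {}"
      proof (rule ccontr)
        assume "\<not> ?thesis"
        then obtain y where y: "y \<in> cball (bctr v) (qdec s)" "y \<notin> bball v" "f y \<in> bball c" by blast
        obtain b' where b': "y \<in> bball b'" "\<Phi> b c v b'" using cover[OF y(1)] by blast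
        \<comment> \<open>Outside the core only the second alternative of \<open>\<Phi>\<close>
          remains, and it contradicts \<open>f y \<in> bball c\<close>.\<close>
        moreover have "\<not> dist (bctr b' :: 'a) (bctr v) \<le> brad v - brad b'"
          using bball_subset[where 'a='a, of b' v] b'(1) y(2) by blast
        ultimately obtain c' where c': "I b' c'" "brad c + brad c' < dist (bctr c' :: 'a) (bctr c)"
          unfolding \<Phi>_def by blast
        have "f y \<in> bball c'" using b'(1) y(1) sub b by (intro enclosureD[OF I c'(1)]) auto
        then show False using c'(2) y(3) dist_triangle2[of "bctr c'" "bctr c" "f y"]
          by (simp add: dist_commute)
      qed
    qed auto
    then show "bball c \<subseteq> f ` bball b" using sub vs(1) by fastforce
  next
    fix b and x :: 'a assume b: "bball b \<subseteq> X" and x: "x \<in> bball b"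
    obtain r where r: "r > 0" "ball x r \<subseteq> bball b" "inj_on f (ball x r)"
    proof -
      obtain r1 where r1: "r1 > 0" "inj_on f (ball x r1 \<inter> X)" using inj b x by blast
      obtain r2 where r2: "r2 > 0" "ball x r2 \<subseteq> bball b" using x open_ball open_contains_ball by blast
      have sub: "ball x (min r1 r2) \<subseteq> bball b" using r2(2) subset_ball[of "min r1 r2" r2 x] by auto
      then have "inj_on f (ball x (min r1 r2))"
        using b by (intro inj_on_subset[OF r1(2)]) auto
      then show ?thesis using that[of "min r1 r2"] r1(1) r2(1) sub by auto
    qed
    obtain v where v: "dist (bctr v) x < r / 16" "r / 8 < brad v" "brad v < r / 4"
      by (rule bball_near[of "r/16" "r/8" "r/4" x]) (use r in auto)
    obtain s where s: "r / 4 < qdec s" "qdec s < r / 2" using qdec_between[of "r/4" "r/2"] r by auto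
    \<comment> \<open>The radius exceeds \<open>qdec s\<close> by more than \<open>r / 4\<close>,
      which leaves room for grid points outside the closed ball that must be covered too. As
      \<open>x\<close> is within \<open>r / 16\<close> of the centre, \<open>K\<close> stays in
      \<open>ball x r\<close>, where \<open>f\<close> is injective, and \<open>x\<close> is not in
      the shell \<open>T\<close>.\<close>
    define K where "K = cball (bctr v :: 'a) (3 * r / 4)"
    define T where "T = K - ball (bctr v) (r / 8)"
    have K: "K \<subseteq> ball x r"
    proof
      fix y assume "y \<in> K"
      then show "y \<in> ball x r"
        using v r(1) dist_triangle[of x y "bctr v"] by (simp add: K_def dist_commute)
    qed
    have KX: "K \<subseteq> X" using K r(2) b by blast
    have "compact (f ` T)"
    proof (rule compact_continuous_image)
      show "continuous_on T f" using KX by (intro continuous_on_subset[OF cont]) (auto simp: T_def)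
      show "compact T" unfolding T_def K_def by (intro compact_diff) auto
    qed
    moreover have "f x \<notin> f ` T"
    proof
      assume "f x \<in> f ` T"
      then obtain t where t: "t \<in> T" "f x = f t" by blast
      then have "t = x" using inj_onD[OF r(3) t(2)] K r(1) by (auto simp: T_def)
      then show False using t(1) v using r by (simp add: T_def)
    qed
    ultimately obtain \<eta> where \<eta>: "\<eta> > 0" "\<And>q. q \<in> T \<Longrightarrow> \<eta> \<le> dist (f x) (f q)"
      using separate_point_closed[of "f ` T" "f x"] compact_imp_closed by blast
    \<comment> \<open>Two radii below \<open>\<eta> / 4\<close> and two centre errors below
      \<open>\<eta> / 8\<close> stay below \<open>\<eta>\<close> in total, so \<open>c\<close> is
      certifiably apart from a ball \<open>c'\<close> around any value taken on
      \<open>T\<close>.\<close>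
    obtain c where c: "dist (bctr c) (f x) < \<eta> / 8" "\<eta> / 8 < brad c" "brad c < \<eta> / 4"
      by (rule bball_near[of "\<eta>/8" "\<eta>/8" "\<eta>/4" "f x"]) (use \<eta> in auto)
    have near: "\<exists>e>0. \<forall>b'. dist (bctr b') q + brad b' < e \<longrightarrow> \<Phi> b c v b'" if q: "q \<in> K" for q
    proof -
      have qb: "q \<in> bball b" using q K r(2) by blast
      obtain e1 where e1: "e1 > 0" "\<And>b'. dist (bctr b') q + brad b' < e1 \<Longrightarrow>
          dist (bctr b' :: 'a) (bctr b) \<le> brad b - brad b'"
        using bball_inside_near[OF qb] by blast
      obtain e2 where e2: "e2 > 0" "\<And>b'. dist (bctr b') q + brad b' < e2 \<Longrightarrow>
        dist (bctr b' :: 'a) (bctr v) \<le> brad v - brad b' \<or>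
         (\<exists>c'. I b' c' \<and> brad c + brad c' < dist (bctr c' :: 'a) (bctr c))"
      proof (cases "q \<in> T")
        case True
        obtain c' where c': "dist (bctr c') (f q) < \<eta> / 8" "\<eta> / 8 < brad c'" "brad c' < \<eta> / 4"
          by (rule bball_near[of "\<eta>/8" "\<eta>/8" "\<eta>/4" "f q"]) (use \<eta> in auto)
        have "dist (f x) (f q) \<le> dist (f x) (bctr c) + dist (bctr c) (bctr c' :: 'a) + dist (bctr c') (f q)"
          using dist_triangle[of "f x" "f q" "bctr c'"] dist_triangle[of "f x" "bctr c'" "bctr c"] by linarith
        then have "brad c + brad c' < dist (bctr c' :: 'a) (bctr c)"
          using \<eta>(2)[OF True] c c' \<eta>(1) by (simp add: dist_commute)
        moreover obtain e where "e > 0" "\<And>b'. dist (bctr b') q + brad b' < e \<Longrightarrow> I b' c'"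
          using enclosure_near[OF I, of q c'] c' q KX by auto
        ultimately show ?thesis using that by blast
      next
        case False
        then have "q \<in> bball v" using q v by (auto simp: T_def)
        then show ?thesis using bball_inside_near that by metis
      qed
      show ?thesis
        by (rule exI[of _ "min e1 e2"]) (use e1 e2 in \<open>auto simp: \<Phi>_def\<close>)
    qed
    have "compact K" by (simp add: K_def)
    then obtain \<epsilon> where \<epsilon>: "\<epsilon> > 0" "\<And>q b'. q \<in> K \<Longrightarrow> dist (bctr b') q + brad b' < \<epsilon> \<Longrightarrow> \<Phi> b c v b'"
      using compact_uniform_near[OF _ near] by blast
    have d: "d > 0" by (simp add: d_def)
    \<comment> \<open>The bound by \<open>\<epsilon> / 4\<close> lets a ball of radius above
      \<open>\<epsilon> / 2\<close>, centred within \<open>\<epsilon> / 8\<close> of a grid point,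
      contain the ball of radius \<open>d * qdec \<delta>\<close> about that point. The bound by
      \<open>r / 4\<close> keeps the relevant grid points in \<open>K\<close>.\<close>
    obtain \<delta> where "0 < qdec \<delta>" "qdec \<delta> < min \<epsilon> r / (4 * d)"
      using qdec_between[of 0 "min \<epsilon> r / (4 * d)"] \<epsilon>(1) r(1) d by auto
    then have \<delta>: "0 < qdec \<delta>" "d * qdec \<delta> < \<epsilon> / 4" "d * qdec \<delta> < r / 4"
      using d by (auto simp: field_simps)
    obtain L where "2 * qdec s / qdec \<delta> < real L" using reals_Archimedean2 by blast
    then have L: "2 * qdec s < qdec \<delta> * real L" using \<delta>(1) by (simp add: field_simps)
    have "\<exists>b'. dist p (bctr b') \<le> brad b' - d * qdec \<delta> \<and> \<Phi> b c v b'"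
      if p: "\<not> qdec s + d * qdec \<delta> < dist p (bctr v)" for p :: 'a
    proof -
      have pK: "p \<in> K" using p s \<delta> by (simp add: K_def dist_commute)
      obtain b' where b': "dist (bctr b') p < \<epsilon> / 8" "\<epsilon> / 2 < brad b'" "brad b' < 3 * \<epsilon> / 4"
        by (rule bball_near[of "\<epsilon>/8" "\<epsilon>/2" "3*\<epsilon>/4" p]) (use \<epsilon> in auto)
      have "\<Phi> b c v b'" by (rule \<epsilon>(2)[OF pK]) (use b' \<epsilon>(1) in linarith)
      moreover have "dist p (bctr b') \<le> brad b' - d * qdec \<delta>"
        using b' \<delta>(2) \<epsilon>(1) by (simp add: dist_commute)
      ultimately show ?thesis by blast
    qed
    moreover have "\<exists>b' c'. 0 < brad b' \<and> dist (bctr b' :: 'a) (bctr v) \<le> brad v - brad b' \<and> I b' c' \<and>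
      dist (bctr c' :: 'a) (bctr c) \<le> brad c - brad c'"
    proof -
      have "f x \<in> bball c" using c by auto
      then obtain e where e: "e > 0" "\<And>c'. dist (bctr c') (f x) + brad c' < e \<Longrightarrow>
          dist (bctr c' :: 'a) (bctr c) \<le> brad c - brad c'"
        using bball_inside_near by blast
      obtain c' where c': "dist (bctr c') (f x) < e / 4" "e / 4 < brad c'" "brad c' < e / 2"
        by (rule bball_near[of "e/4" "e/4" "e/2" "f x"]) (use e in auto)
      have "x \<in> bball v" "x \<in> X" using v r(1) b x by auto
      then obtain b' where "0 < brad b'" "dist (bctr b' :: 'a) (bctr v) \<le> brad v - brad b'" "I b' c'"
        using enclosure_inside[OF I, of x v c'] c' by auto
      moreover have "dist (bctr c' :: 'a) (bctr c) \<le> brad c - brad c'" using c' e(1) by (intro e(2)) auto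
      ultimately show ?thesis by blast
    qed
    moreover have "brad v < qdec s" using v s by linarith
    ultimately have "R b c" unfolding R_def using \<delta>(1) L by blast
    then show "\<exists>c. f x \<in> bball c \<and> R b c" using c by (intro exI[of _ c]) auto
  qed
qed

section \<open>Submersions\<close>

text \<open>Solutions of \<open>g u = y\<close> are fixed points of \<open>u + (y - g u)\<close>.
  The derivative bound makes \<open>g u - u\<close> Lipschitz with constant 1/2, so for
  \<open>y\<close> within \<open>r / 2\<close> of \<open>g 0\<close> this map sends
  \<open>cball 0 r\<close> into itself, and Brouwer's theorem applies.\<close>

lemma ball_subset_image_near_identity:
  fixes g :: "'a::euclidean_space \<Rightarrow> 'a"
  assumes r: "r > 0"
    and der: "\<And>u. u \<in> cball 0 r \<Longrightarrow> (g has_derivative g' u) (at u within cball 0 r)"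
    and near: "\<And>u h. u \<in> cball 0 r \<Longrightarrow> norm (g' u h - h) \<le> norm h / 2"
  shows "ball (g 0) (r / 2) \<subseteq> g ` cball 0 r"
proof
  fix y assume y: "y \<in> ball (g 0) (r / 2)"
  have "\<exists>u\<in>cball 0 r. g u = y"
  proof (rule brouwer_surjective_cball[where S = "{y}"])
    show "continuous_on (cball 0 r) g"
      using der by (meson has_derivative_continuous_on)
    fix z u :: 'a assume z: "z \<in> {y}" and u: "u \<in> cball 0 r"
    have "norm ((g u - u) - (g 0 - 0)) \<le> 1/2 * norm (u - 0)"
    proof (rule differentiable_bound[of "cball 0 r" _ "\<lambda>u h. g' u h - h"])
      show "((\<lambda>u. g u - u) has_derivative (\<lambda>h. g' x h - h)) (at x within cball 0 r)"
        if "x \<in> cball 0 r" for x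
        using der[OF that] by (auto intro: derivative_intros)
      show "onorm (\<lambda>h. g' x h - h) \<le> 1/2" if "x \<in> cball 0 r" for x
        using near[OF that] by (intro onorm_le) simp
    qed (use u r in auto)
    moreover have "norm (y - g 0) \<le> r / 2"
      using y by (simp add: dist_norm norm_minus_commute)
    moreover have "norm (z + (u - g u)) \<le> norm (y - g 0) + norm ((g u - u) - (g 0 - 0))"
      using z norm_triangle_ineq4[of "y - g 0" "(g u - u) - (g 0 - 0)"] by (simp add: algebra_simps)
    ultimately show "z + (u - g u) \<in> cball 0 r" using u by simp
  qed (use r in auto)
  then show "y \<in> g ` cball 0 r" by blast
qed

text \<open>Since \<open>f'\<close> applied to the vectors \<open>v j\<close> is close to the standard basis on the whole ball,
  restricting \<open>f\<close> to the affine slice through \<open>a\<close> spanned by the \<open>v j\<close> gives a map close to the identity.\<close>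

lemma ball_subset_image_right_inverse:
  fixes f :: "'a::euclidean_space \<Rightarrow> 'b::euclidean_space" and v :: "nat \<Rightarrow> 'a"
  assumes der: "\<And>x. x \<in> ball a \<rho> \<Longrightarrow> (f has_derivative f' x) (at x)"
    and near: "\<And>x j. x \<in> ball a \<rho> \<Longrightarrow> j < DIM('b) \<Longrightarrow>
      norm (f' x (v j) - basis_enum j) \<le> 1 / (2 * real DIM('b))"
    and B: "\<And>j. j < DIM('b) \<Longrightarrow> norm (v j) \<le> B"
    and r: "r > 0" "real DIM('b) * B * r < \<rho>"
  shows "ball (f a) (r / 2) \<subseteq> f ` ball a \<rho>"
proof -
  define M where "M u = (\<Sum>j<DIM('b). (u \<bullet> basis_enum j) *\<^sub>R v j)" for u :: 'b
  have coord: "\<bar>u \<bullet> basis_enum j\<bar> \<le> norm u" if "j < DIM('b)" for u :: 'b and j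
    using that by (intro Basis_le_norm) simp
  have M_le: "norm (M u) \<le> real DIM('b) * B * norm u" for u
  proof -
    have "norm (M u) \<le> (\<Sum>j<DIM('b). norm u * B)"
      unfolding M_def
    proof (rule sum_norm_le)
      fix j assume "j \<in> {..<DIM('b)}"
      then show "norm ((u \<bullet> basis_enum j) *\<^sub>R v j) \<le> norm u * B"
        using coord[of j u] B[of j] by (auto intro: mult_mono)
    qed
    then show ?thesis by (simp add: mult.commute mult.left_commute)
  qed
  have M_der: "(M has_derivative M) (at u within S)" for u S
  proof -
    have "bounded_linear M" unfolding M_def[abs_def]
      by (intro bounded_linear_sum bounded_linear_scaleR_const bounded_linear_inner_left)
    then show ?thesis by (rule bounded_linear_imp_has_derivative)
  qed
  have in_ball: "a + M u \<in> ball a \<rho>" if "u \<in> cball 0 r" for u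
  proof -
    have "0 \<le> B" using B[of 0] norm_ge_zero[of "v 0"] by (simp del: norm_ge_zero)
    then have "real DIM('b) * B * norm u \<le> real DIM('b) * B * r"
      using that by (intro mult_left_mono) auto
    then have "norm (M u) < \<rho>" using M_le[of u] r(2) by linarith
    then show ?thesis by (simp add: dist_norm)
  qed
  let ?g = "\<lambda>u. f (a + M u)"
  have "ball (?g 0) (r / 2) \<subseteq> ?g ` cball 0 r"
  proof (rule ball_subset_image_near_identity[OF r(1), where g' = "\<lambda>u h. f' (a + M u) (M h)"])
    fix u :: 'b assume u: "u \<in> cball 0 r"
    have "((\<lambda>u. a + M u) has_derivative M) (at u within cball 0 r)"
      using has_derivative_add[OF has_derivative_const[of a] M_der] by simp
    from has_derivative_compose[OF this der[OF in_ball[OF u]]]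
    show "(?g has_derivative (\<lambda>h. f' (a + M u) (M h))) (at u within cball 0 r)" .
    fix h :: 'b
    interpret L: linear "f' (a + M u)" using der[OF in_ball[OF u]] by (rule has_derivative_linear)
    have "(\<Sum>j<DIM('b). (h \<bullet> basis_enum j) *\<^sub>R basis_enum j) = h"
      using euclidean_representation[of h] by (simp add: sum_Basis_enum)
    moreover have "f' (a + M u) (M h) = (\<Sum>j<DIM('b). (h \<bullet> basis_enum j) *\<^sub>R f' (a + M u) (v j))"
      unfolding M_def[of h] by (simp add: L.sum L.scale)
    ultimately have "f' (a + M u) (M h) - h =
      (\<Sum>j<DIM('b). (h \<bullet> basis_enum j) *\<^sub>R (f' (a + M u) (v j) - basis_enum j))"
      by (simp add: scaleR_diff_right sum_subtractf)
    \<comment> \<open>The tolerance in \<open>near\<close> is chosen for this sum: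
      \<open>DIM('b)\<close> such terms add up to \<open>norm h / 2\<close>.\<close>
    also have "norm \<dots> \<le> (\<Sum>j<DIM('b). norm h * (1 / (2 * real DIM('b))))"
    proof (rule sum_norm_le)
      fix j assume "j \<in> {..<DIM('b)}"
      then show "norm ((h \<bullet> basis_enum j) *\<^sub>R (f' (a + M u) (v j) - basis_enum j))
        \<le> norm h * (1 / (2 * real DIM('b)))"
        unfolding norm_scaleR using coord[of j h] near[OF in_ball[OF u], of j]
        by (intro mult_mono) auto
    qed
    also have "\<dots> = norm h / 2" by simp
    finally show "norm (f' (a + M u) (M h) - h) \<le> norm h / 2" .
  qed
  moreover have "M 0 = 0" by (simp add: M_def)
  ultimately show ?thesis using in_ball by fastforce
qed

text \<open>Enclosures are available only for the derivative at basis vectors. Expanding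
  \<open>v\<close> in the basis transfers them to \<open>v\<close>, at the cost of one error
  \<open>t\<close> with weight at most \<open>B\<close> per coordinate.\<close>

lemma linear_combination_error:
  fixes F :: "'a::euclidean_space \<Rightarrow> 'b::euclidean_space"
  assumes F: "linear F" and v: "norm v \<le> B"
    and w: "\<And>k. k < DIM('a) \<Longrightarrow> norm (F (basis_enum k) - w k) \<le> t"
  shows "norm (F v - (\<Sum>k<DIM('a). (v \<bullet> basis_enum k) *\<^sub>R w k)) \<le> real DIM('a) * B * t"
proof -
  interpret L: linear F by fact
  have "v = (\<Sum>k<DIM('a). (v \<bullet> basis_enum k) *\<^sub>R basis_enum k)"
    using euclidean_representation[of v] by (simp add: sum_Basis_enum)
  then have "F v = (\<Sum>k<DIM('a). (v \<bullet> basis_enum k) *\<^sub>R F (basis_enum k))"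
    by (metis (mono_tags, lifting) L.scale L.sum sum.cong)
  then have "F v - (\<Sum>k<DIM('a). (v \<bullet> basis_enum k) *\<^sub>R w k) =
      (\<Sum>k<DIM('a). (v \<bullet> basis_enum k) *\<^sub>R (F (basis_enum k) - w k))"
    by (simp add: scaleR_diff_right sum_subtractf)
  also have "norm \<dots> \<le> (\<Sum>k<DIM('a). B * t)"
  proof (rule sum_norm_le)
    fix k assume "k \<in> {..<DIM('a)}"
    then have "\<bar>v \<bullet> basis_enum k\<bar> \<le> B" "norm (F (basis_enum k) - w k) \<le> t"
      using Basis_le_norm[of "basis_enum k" v] v w[of k] by auto
    moreover have "0 \<le> B" using v norm_ge_zero[of v] by linarith
    ultimately show "norm ((v \<bullet> basis_enum k) *\<^sub>R (F (basis_enum k) - w k)) \<le> B * t"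
      unfolding norm_scaleR by (intro mult_mono) auto
  qed
  finally show ?thesis by (simp add: mult.assoc)
qed

lemma lnth_list_encode_map: "i < n \<Longrightarrow> lnth (list_encode (map g [0..<n])) i = g i"
  by (simp add: nth_default_def)

theorem effectively_open_submersion:
  fixes f :: "'a::euclidean_space \<Rightarrow> 'b::euclidean_space"
  assumes comp: "computable_on X f"
    and der: "\<And>x. x \<in> X \<Longrightarrow> (f has_derivative f' x) (at x)"
    and comp': "\<And>v. v \<in> Basis \<Longrightarrow> computable_on X (\<lambda>x. f' x v)"
    and rank: "\<And>x. x \<in> X \<Longrightarrow> dim (range (f' x)) = DIM('b)"
  shows "effectively_open X f"
proof -
  obtain I where I: "enclosure_relation X f I" using computable_on_enclosure[OF comp] by blast
  have "\<exists>J. enclosure_relation X (\<lambda>x. f' x (basis_enum k)) J" if "k < DIM('a)" for k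
    using that by (intro computable_on_enclosure comp') simp
  then obtain J where J: "\<And>k. k < DIM('a) \<Longrightarrow> enclosure_relation X (\<lambda>x. f' x (basis_enum k)) (J k)"
    by metis
  \<comment> \<open>The tolerance of \<open>ball_subset_image_right_inverse\<close>; being rational,
    it has a code \<open>q\<close> to which the certificate can refer.\<close>
  define \<kappa> where "\<kappa> = 1 / (2 * real DIM('b))"
  have \<kappa>: "\<kappa> > 0" by (simp add: \<kappa>_def)
  obtain q where q: "qdec q = \<kappa>"
    using qdec_surj_rat[of \<kappa>] by (auto simp: \<kappa>_def)
  define v where "v V j = (qpoint (lnth V j) :: 'a)" for V j
  define S where "S V W j = (\<Sum>k<DIM('a). (v V j \<bullet> basis_enum k) *\<^sub>R (bctr (lnth W k) :: 'b))" for V W j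
  \<comment> \<open>\<open>V\<close> codes an approximate right inverse with norm bound
    \<open>B\<close>, and \<open>W\<close> encloses the partial derivatives on all of
    \<open>b'\<close> with radii at most \<open>qdec t\<close>. Subtracting the error of
    \<open>linear_combination_error\<close> makes the estimate hold for the true derivative
    throughout \<open>b'\<close>. The slice has radius \<open>2 * qdec \<delta>\<close>, so the
    image contains the ball of radius \<open>qdec \<delta>\<close> about the value at the centre of
    \<open>b'\<close>. That value is known only through \<open>b1\<close>, concentric with
    \<open>b'\<close>, and its enclosure \<open>c1\<close>.\<close>
  define R where "R b c \<longleftrightarrow> (\<exists>b' V W B t \<delta> b1 c1. 0 < brad b' \<and>
    dist (bctr b' :: 'a) (bctr b) \<le> brad b - brad b' \<and>
    (\<forall>k\<in>{..<DIM('a)}. J k b' (lnth W k) \<and> brad (lnth W k) \<le> qdec t) \<and>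
    (\<forall>j\<in>{..<DIM('b)}. norm (v V j) \<le> real B \<and>
      norm (S V W j - basis_enum j) \<le> qdec q - real DIM('a) * real B * qdec t) \<and>
    0 < qdec \<delta> \<and> real DIM('b) * real B * (2 * qdec \<delta>) < brad b' \<and>
    pfst b1 = pfst b' \<and> 0 < brad b1 \<and> I b1 c1 \<and>
    dist (bctr c1 :: 'b) (bctr c) \<le> qdec \<delta> - brad c - brad c1)" for b c
  show ?thesis
  proof (rule effectively_openI[of R])
    show "semidecidable (\<lambda>u. R (pfst u) (psnd u))"
      unfolding R_def S_def v_def
      by (intro recursive_intros semidecidable_enclosure[OF I] semidecidable_enclosure[OF J]) auto
  next
    fix b c assume b: "(bball b :: 'a set) \<subseteq> X" and "R b c"
    then obtain b' V W B t \<delta> b1 c1 where b': "0 < brad b'"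
      "dist (bctr b' :: 'a) (bctr b) \<le> brad b - brad b'"
      and W: "\<And>k. k < DIM('a) \<Longrightarrow> J k b' (lnth W k)" "\<And>k. k < DIM('a) \<Longrightarrow> brad (lnth W k) \<le> qdec t"
      and V: "\<And>j. j < DIM('b) \<Longrightarrow> norm (v V j) \<le> real B" "\<And>j. j < DIM('b) \<Longrightarrow>
        norm (S V W j - basis_enum j) \<le> qdec q - real DIM('a) * real B * qdec t"
      and \<delta>: "0 < qdec \<delta>" "real DIM('b) * real B * (2 * qdec \<delta>) < brad b'"
      and b1: "pfst b1 = pfst b'" "0 < brad b1" "I b1 c1"
        "dist (bctr c1 :: 'b) (bctr c) \<le> qdec \<delta> - brad c - brad c1"
      unfolding R_def by (metis lessThan_iff)
    have sub: "bball b' \<subseteq> (bball b :: 'a set)" by (rule bball_subset[OF b'(2)])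
    have "ball (f (bctr b')) (2 * qdec \<delta> / 2) \<subseteq> f ` bball b'"
    proof (rule ball_subset_image_right_inverse[where f' = f' and v = "v V" and B = "real B"])
      show "(f has_derivative f' x) (at x)" if "x \<in> bball b'" for x
        using that sub b by (intro der) blast
      fix x :: 'a and j assume x: "x \<in> bball b'" and j: "j < DIM('b)"
      have xX: "x \<in> X" using x sub b by blast
      have "norm (f' x (v V j) - S V W j) \<le> real DIM('a) * real B * qdec t"
        unfolding S_def
      proof (rule linear_combination_error)
        show "linear (f' x)" using der[OF xX] by (rule has_derivative_linear)
        fix k assume k: "k < DIM('a)"
        have "f' x (basis_enum k) \<in> bball (lnth W k)"
          by (rule enclosureD[OF J[OF k] W(1)[OF k] x xX])
        then show "norm (f' x (basis_enum k) - bctr (lnth W k)) \<le> qdec t"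
          using W(2)[OF k] by (simp add: dist_norm norm_minus_commute)
      qed (rule V(1)[OF j])
      then have "norm (f' x (v V j) - basis_enum j) \<le> qdec q"
        using V(2)[OF j] norm_triangle_ineq[of "f' x (v V j) - S V W j" "S V W j - basis_enum j"]
        by simp
      then show "norm (f' x (v V j) - basis_enum j) \<le> 1 / (2 * real DIM('b))"
        by (simp add: q \<kappa>_def)
    qed (use \<delta> V(1) in auto)
    then have "ball (f (bctr b')) (qdec \<delta>) \<subseteq> f ` bball b" using image_mono[OF sub] by fastforce
    moreover have "bball c \<subseteq> ball (f (bctr b')) (qdec \<delta>)"
    proof
      have "bctr b' \<in> X" using sub b b'(1) by (meson centre_in_ball subsetD)
      then have "f (bctr b') \<in> bball c1"
        using b1(1,2) by (intro enclosureD[OF I b1(3)]) auto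
      moreover fix y :: 'b assume "y \<in> bball c"
      ultimately show "y \<in> ball (f (bctr b')) (qdec \<delta>)"
        using b1(4) dist_triangle[of "f (bctr b')" y "bctr c1"] dist_triangle[of "bctr c1" y "bctr c"]
        by (simp add: dist_commute)
    qed
    ultimately show "bball c \<subseteq> f ` bball b" by blast
  next
    fix b and x :: 'a assume b: "bball b \<subseteq> X" and x: "x \<in> bball b"
    have xX: "x \<in> X" using x b by blast
    have lin: "linear (f' x)" using der[OF xX] by (rule has_derivative_linear)
    obtain A where A: "A > 0" "\<And>y. norm (f' x y) \<le> A * norm y"
      using linear_bounded_pos[OF lin] by blast
    have surj: "surj (f' x)"
      using rank[OF xX] dim_eq_full[of "range (f' x)"] lin
      by (metis linear_subspace_image span_eq_iff subspace_UNIV)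
    \<comment> \<open>Surjectivity gives an exact preimage of the basis vector; a rational point
      near it is good enough because \<open>f' x\<close> is bounded.\<close>
    have "\<exists>k. norm (f' x (qpoint k) - basis_enum j) < \<kappa> / 4" for j
    proof -
      obtain w where w: "f' x w = basis_enum j" using surj by (metis surjD)
      obtain k where k: "dist (qpoint k) w < \<kappa> / 4 / A"
        using qpoint_near[of "\<kappa> / 4 / A" w] \<kappa> A(1) by auto
      have "norm (f' x (qpoint k) - basis_enum j) \<le> A * norm (qpoint k - w)"
        using A(2)[of "qpoint k - w"] by (simp add: w linear_diff[OF lin])
      also have "\<dots> < \<kappa> / 4" using k A(1) by (simp add: dist_norm field_simps)
      finally show ?thesis by blast
    qed
    then obtain vc where vc: "\<And>j. norm (f' x (qpoint (vc j)) - basis_enum j) < \<kappa> / 4" by metis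
    define V where "V = list_encode (map vc [0..<DIM('b)])"
    have V: "v V j = qpoint (vc j)" if "j < DIM('b)" for j
      unfolding v_def V_def by (simp only: lnth_list_encode_map[OF that])
    obtain B where B: "(\<Sum>j<DIM('b). norm (v V j)) < real B" using reals_Archimedean2 by blast
    have vB: "norm (v V j) \<le> real B" if "j < DIM('b)" for j
      using member_le_sum[of j "{..<DIM('b)}" "\<lambda>j. norm (v V j)"] that B by simp
    have "B > 0" using vB[of 0] B sum_nonneg[of "{..<DIM('b)}" "\<lambda>j. norm (v V j)"] by (cases B) auto
    define nB where "nB = real DIM('a) * real B"
    define mB where "mB = real DIM('b) * real B"
    have nB: "nB > 0" "mB > 0" using \<open>B > 0\<close> by (auto simp: nB_def mB_def)
    obtain t where t: "0 < qdec t" "qdec t < \<kappa> / 4 / nB"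
      using qdec_between[of 0 "\<kappa> / 4 / nB"] \<kappa> nB by auto
    have nBt: "nB * qdec t < \<kappa> / 4" using t(2) nB(1) by (simp add: field_simps)
    have "\<exists>c. dist (bctr c) (f' x (basis_enum k)) < qdec t / 2 \<and> qdec t / 2 < brad c \<and> brad c < qdec t" for k
      using bball_near[of "qdec t / 2" "qdec t / 2" "qdec t" "f' x (basis_enum k)"] t(1) by (metis half_gt_zero field_sum_of_halves less_add_same_cancel1)
    then obtain wc where wc: "\<And>k. dist (bctr (wc k)) (f' x (basis_enum k)) < qdec t / 2"
      "\<And>k. qdec t / 2 < brad (wc k)" "\<And>k. brad (wc k) < qdec t" by metis
    define W where "W = list_encode (map wc [0..<DIM('a)])"
    have W: "lnth W k = wc k" if "k < DIM('a)" for k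
      unfolding W_def by (rule lnth_list_encode_map[OF that])
    \<comment> \<open>Three quarters of \<open>\<kappa>\<close> are spent: on the rational
      preimages, on replacing the derivative at \<open>x\<close> by the centres in \<open>W\<close>,
      and on the term that the certificate subtracts.\<close>
    have S: "norm (S V W j - basis_enum j) \<le> qdec q - nB * qdec t" if j: "j < DIM('b)" for j
    proof -
      have "norm (f' x (v V j) - S V W j) \<le> nB * qdec t"
        unfolding S_def nB_def
      proof (rule linear_combination_error[OF lin vB[OF j]])
        fix k assume k: "k < DIM('a)"
        show "norm (f' x (basis_enum k) - bctr (lnth W k)) \<le> qdec t"
          unfolding W[OF k] using wc(1)[of k] t(1) by (simp add: dist_norm norm_minus_commute)
      qed
      then show ?thesis
        using vc[of j] nBt \<kappa> norm_triangle_ineq[of "S V W j - f' x (v V j)" "f' x (v V j) - basis_enum j"]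
        by (simp add: q V[OF j] norm_minus_commute)
    qed
    have "\<exists>e>0. \<forall>b'. dist (bctr b') x + brad b' < e \<longrightarrow> J k b' (wc k)" if k: "k < DIM('a)" for k
    proof -
      have "f' x (basis_enum k) \<in> bball (wc k)" using wc(1,2)[of k] by auto
      then show ?thesis using enclosure_near[OF J[OF k] xX] by blast
    qed
    then obtain e where e: "\<And>k. k < DIM('a) \<Longrightarrow> e k > 0"
      "\<And>k b'. k < DIM('a) \<Longrightarrow> dist (bctr b') x + brad b' < e k \<Longrightarrow> J k b' (wc k)" by metis
    obtain e0 where e0: "e0 > 0" "\<And>b'. dist (bctr b') x + brad b' < e0 \<Longrightarrow>
        dist (bctr b' :: 'a) (bctr b) \<le> brad b - brad b'"
      using bball_inside_near[OF x] by blast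
    define E where "E = Min (insert e0 (e ` {..<DIM('a)}))"
    have E: "E > 0" "E \<le> e0" "\<And>k. k < DIM('a) \<Longrightarrow> E \<le> e k"
      unfolding E_def using e0(1) e(1) by auto
    \<comment> \<open>Chosen before \<open>b'\<close>, so that any radius above \<open>E / 4\<close>
      satisfies the size condition of the certificate.\<close>
    obtain \<delta> where \<delta>: "0 < qdec \<delta>" "qdec \<delta> < E / 8 / mB"
      using qdec_between[of 0 "E / 8 / mB"] E(1) nB by auto
    have mB\<delta>: "mB * (2 * qdec \<delta>) < E / 4" using \<delta>(2) nB(2) by (simp add: field_simps)
    \<comment> \<open>The value at the centre of \<open>b'\<close> must be close to
      \<open>f x\<close> on the scale of \<open>\<delta>\<close>, while the radius of
      \<open>b'\<close> must stay of order \<open>E\<close>. Hence the bound \<open>d\<close>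
      restricts the centre alone.\<close>
    obtain d where d: "d > 0" "\<And>y. y \<in> X \<Longrightarrow> dist y x < d \<Longrightarrow> dist (f y) (f x) < qdec \<delta> / 8"
      using computable_on_continuous_on[OF comp] xX \<delta>(1)
      unfolding continuous_on_iff by (metis half_gt_zero zero_less_divide_iff zero_less_numeral)
    obtain b' where b': "dist (bctr b') x < min d (E / 4)" "E / 4 < brad b'" "brad b' < E / 2"
      by (rule bball_near[of "min d (E / 4)" "E/4" "E/2" x]) (use d E in auto)
    have b'E: "dist (bctr b') x + brad b' < E" using b' E(1) by simp
    have incl: "dist (bctr b' :: 'a) (bctr b) \<le> brad b - brad b'" using b'E E(2) by (intro e0(2)) linarith
    have "bctr b' \<in> (bball b' :: 'a set)" using b'(2) E(1) by simp
    then have aX: "bctr b' \<in> X" using bball_subset[OF incl] b by blast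
    have fa: "dist (f (bctr b')) (f x) < qdec \<delta> / 8" using d(2)[OF aX] b'(1) by simp
    obtain c1 where c1: "dist (bctr c1) (f x) < qdec \<delta> / 8" "qdec \<delta> / 4 < brad c1" "brad c1 < qdec \<delta> / 2"
      by (rule bball_near[of "qdec \<delta> / 8" "qdec \<delta> / 4" "qdec \<delta> / 2" "f x"]) (use \<delta> in auto)
    have "f (bctr b') \<in> bball c1"
      using c1 fa dist_triangle2[of "bctr c1" "f (bctr b')" "f x"] by simp
    then obtain e1 where e1: "e1 > 0" "\<And>b1. dist (bctr b1) (bctr b' :: 'a) + brad b1 < e1 \<Longrightarrow> I b1 c1"
      using enclosure_near[OF I aX] by blast
    \<comment> \<open>The image of \<open>b'\<close> itself may be too large for \<open>c1\<close>,
      so its centre is kept and the radius is shrunk.\<close>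
    obtain r where r: "0 < qdec r" "qdec r < e1" using qdec_between[OF e1(1)] by blast
    define b1 where "b1 = prod_encode (pfst b', r)"
    have b1: "pfst b1 = pfst b'" "0 < brad b1" "I b1 c1"
      using r by (auto simp: b1_def intro!: e1(2))
    obtain c where c: "dist (bctr c) (f x) < qdec \<delta> / 16" "qdec \<delta> / 16 < brad c" "brad c < qdec \<delta> / 8"
      by (rule bball_near[of "qdec \<delta> / 16" "qdec \<delta> / 16" "qdec \<delta> / 8" "f x"]) (use \<delta> in auto)
    \<comment> \<open>Distance, \<open>brad c\<close> and \<open>brad c1\<close> are below 3/16, 1/8
      and 1/2 of \<open>qdec \<delta>\<close>.\<close>
    have cc: "dist (bctr c1 :: 'b) (bctr c) \<le> qdec \<delta> - brad c - brad c1"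
      using c c1 dist_triangle2[of "bctr c1" "bctr c" "f x"] by simp
    have "R b c"
      unfolding R_def
    proof (intro exI conjI ballI)
      show "0 < brad b'" using b'(2) E(1) by simp
      show "dist (bctr b' :: 'a) (bctr b) \<le> brad b - brad b'" by (rule incl)
      show "J k b' (lnth W k)" "brad (lnth W k) \<le> qdec t" if "k \<in> {..<DIM('a)}" for k
        using that e(2)[of k b'] E(3)[of k] b'E wc(3)[of k] by (auto simp: W)
      show "norm (v V j) \<le> real B" "norm (S V W j - basis_enum j) \<le> qdec q - real DIM('a) * real B * qdec t"
        if "j \<in> {..<DIM('b)}" for j
        using that vB S by (auto simp: nB_def)
      show "0 < qdec \<delta>" by (rule \<delta>)
      show "real DIM('b) * real B * (2 * qdec \<delta>) < brad b'"
        using mB\<delta> b'(2) by (simp add: mB_def)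
    qed (fact b1 cc)+
    then show "\<exists>c. f x \<in> bball c \<and> R b c" using c by (intro exI[of _ c]) auto
  qed
qed

text \<open>Three criteria cover all parts: convex images of balls, surjective derivatives and local
  injectivity. For the last criterion a ball of injectivity about each point comes from an element
  of \<open>h x\<close>, from local injectivity on the closure, or from injectivity on all of
  \<open>X\<close>.\<close>

theorem theorem3:
  fixes X :: "'a::euclidean_space set"
  assumes "re_open X"
  shows
   "(\<forall>f :: 'a \<Rightarrow> real. computable_on X f \<and> open_on X f \<longrightarrow> effectively_open X f)
  \<and> (\<forall>f :: 'a \<Rightarrow> 'b::euclidean_space.
        computable_on X f \<and> open_on X f \<and>
        (\<forall>c r. 0 < r \<and> ball c r \<subseteq> X \<longrightarrow> convex (f ` ball c r))
        \<longrightarrow> effectively_open X f)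
  \<and> (\<forall>f :: 'a \<Rightarrow> 'b::euclidean_space.
        (\<exists>A b. linear A \<and> f = (\<lambda>x. A x + b)) \<and> surj f \<and> computable_on UNIV f
        \<longrightarrow> effectively_open UNIV f)
  \<and> (\<forall>(f :: 'a \<Rightarrow> 'b::euclidean_space) (f' :: 'a \<Rightarrow> 'a \<Rightarrow> 'b).
        computable_on X f \<and>
        (\<forall>x\<in>X. (f has_derivative f' x) (at x)) \<and>
        (\<forall>v. continuous_on X (\<lambda>x. f' x v)) \<and>
        (\<forall>v\<in>Basis. computable_on X (\<lambda>x. f' x v)) \<and>
        (\<forall>x\<in>X. dim (range (f' x)) = DIM('b))
        \<longrightarrow> effectively_open X f)
  \<and> (\<forall>(f :: 'a \<Rightarrow> 'a) (h :: 'a \<Rightarrow> nat set).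
        computable_on X f \<and> mv_computable X h \<and> (\<forall>x\<in>X. h x \<noteq> {}) \<and>
        (\<forall>x\<in>X. \<forall>l\<in>h x. inj_on f (ball x ((1/2) ^ l) \<inter> X))
        \<longrightarrow> effectively_open X f)
  \<and> (\<forall>f :: 'a \<Rightarrow> 'a.
        bounded X \<and> computable_on (closure X) f \<and>
        (\<forall>x\<in>closure X. \<exists>r>0. inj_on f (ball x r \<inter> closure X))
        \<longrightarrow> effectively_open X f)
  \<and> (\<forall>f :: 'a \<Rightarrow> 'a. computable_on X f \<and> inj_on f X \<longrightarrow> effectively_open X f)"
proof (intro conjI allI impI; (elim conjE exE)?)
  show "effectively_open X f" if "computable_on X f" "open_on X f" for f :: "'a \<Rightarrow> real"
    using that by (rule effectively_open_real)
next
  fix f :: "'a \<Rightarrow> 'b"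
  assume "computable_on X f" "open_on X f" "\<forall>c r. 0 < r \<and> ball c r \<subseteq> X \<longrightarrow> convex (f ` ball c r)"
  then show "effectively_open X f" by (intro effectively_open_convex) auto
next
  fix f A and b :: 'b
  assume "surj f" "computable_on UNIV f" "linear (A :: 'a \<Rightarrow> 'b)" "f = (\<lambda>x. A x + b)"
  then show "effectively_open UNIV f" by (intro effectively_open_affine)
next
  fix f :: "'a \<Rightarrow> 'b" and f' :: "'a \<Rightarrow> 'a \<Rightarrow> 'b"
  assume "computable_on X f" "\<forall>x\<in>X. (f has_derivative f' x) (at x)"
    "\<forall>v\<in>Basis. computable_on X (\<lambda>x. f' x v)" "\<forall>x\<in>X. dim (range (f' x)) = DIM('b)"
  then show "effectively_open X f" by (intro effectively_open_submersion[of X f f']) auto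
next
  fix f :: "'a \<Rightarrow> 'a" and h :: "'a \<Rightarrow> nat set"
  assume f: "computable_on X f" and h: "\<forall>x\<in>X. h x \<noteq> {}"
    "\<forall>x\<in>X. \<forall>l\<in>h x. inj_on f (ball x ((1/2) ^ l) \<inter> X)"
  show "effectively_open X f"
  proof (rule effectively_open_locally_injective[OF f])
    fix x assume "x \<in> X"
    then obtain l where "inj_on f (ball x ((1/2) ^ l) \<inter> X)" using h by blast
    then show "\<exists>r>0. inj_on f (ball x r \<inter> X)" by (intro exI[of _ "(1/2) ^ l"]) simp
  qed
next
  fix f :: "'a \<Rightarrow> 'a"
  assume f: "computable_on (closure X) f" and inj: "\<forall>x\<in>closure X. \<exists>r>0. inj_on f (ball x r \<inter> closure X)"
  show "effectively_open X f"
  proof (rule effectively_open_locally_injective)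
    show "computable_on X f" using f closure_subset by (rule computable_on_subset)
    fix x assume "x \<in> X"
    then obtain r where "r > 0" "inj_on f (ball x r \<inter> closure X)" using inj closure_subset by blast
    then show "\<exists>r>0. inj_on f (ball x r \<inter> X)"
      using closure_subset by (meson Int_mono inj_on_subset order_refl)
  qed
next
  fix f :: "'a \<Rightarrow> 'a"
  assume f: "computable_on X f" and inj: "inj_on f X"
  show "effectively_open X f"
    by (rule effectively_open_locally_injective[OF f])
      (meson Int_lower2 inj inj_on_subset zero_less_one)
qed

end
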